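(* (Primal objective convergence) Let $\{\mu_i^k,\mathbf{G}_i^k,\mathbf{x}^k\}$, $i\in V$, be the dual and primal variables generated by the algorithm CoBa-DD described in the context, with bounded initial values $\mu_i^0,\mathbf{G}_i^0$. Suppose the convexity/compactness, existence and Slater assumptions hold and that $\mathbf{W}$ satisfies the consensus-matrix conditions (all stated in the context). Let $\beta_0\ge c_0$ with $c_0$ as in the context, let $M=L+Q$, let $\Lambda,\Gamma$ be as in the context, choose a scalar $\tau$ with $\beta_0/\alpha\le\tau$, and let $\zeta$ be the scalar associated in the context with the concave function $q$ and the choice of $\tau$. Let $f^*$ be the optimal value of the primal problem. Let $\varphi\ge\bar\varphi+\delta$ with $\delta\ge0$ and $$\bar\varphi=\frac{\log(\beta_0)-\log\big(4n(1+d^2)(\beta_0+\alpha M)\big)}{\log(\nu)}.$$ Then, for all $k\ge1$: (a) $\displaystyle f(\mathbf{x}^k)\le f^*+\frac{\Lambda^2+\Gamma^2}{2k\alpha/n}+e_k$; (b) $\displaystyle f(\mathbf{x}^k)\ge f^*-\frac{9(\Lambda^2+\Gamma^2)}{2k\alpha/n}-e_k$; where $$e_k=\frac{\alpha n(M+\tau)^2}{2}+n\tau(\Lambda+\Gamma)+n\big(\beta_0(6M+3\tau)+\zeta\big).$$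
   Context: Problem. Let $V=\{1,\dots,n\}$ be the nodes of an undirected time-invariant communication graph, with $N_i$ the set of neighbours of node $i$. For $i\in V$ let $f_i,g_i:\mathbb{R}\to\mathbb{R}$ be convex and $X_i\subset\mathbb{R}$ convex and compact; $X=\prod_{i\in V}X_i$. Let $\mathbf{A}_0,\mathbf{A}_i$ ($i\in V$) be real symmetric $d\times d$ matrices. The problem is $$\min_{x_i\in X_i,\,i\in V} f(\mathbf{x}):=\sum_{i\in V}f_i(x_i)\quad\text{s.t.}\quad \sum_{i\in V}g_i(x_i)\le 0,\quad \mathbf{A}_0+\sum_{i\in V}\mathbf{A}_ix_i\succeq 0.$$ Existence assumption: the feasible set $F$ is nonempty, $f(\mathbf{x})>-\infty$ for all $\mathbf{x}\in F$, and $f(\mathbf{x})<\infty$ for some $\mathbf{x}\in F$. Slater assumption: there is $\bar{\mathbf{x}}\in X$ with $\sum_i g_i(\bar x_i)<0$ and $\mathbf{A}_0+\sum_i\mathbf{A}_i\bar x_i\succ0$. Dual. $\mathbb{S}^d_+$ is the cone of positive semidefinite $d\times d$ matrices. For $\mu\in\mathbb{R}_+$, $\mathbf{G}\in\mathbb{S}_+^d$, let $L_i(x_i,\mu,\mathbf{G})=f_i(x_i)+\mu g_i(x_i)-\mathrm{tr}[(\mathbf{A}_0/n+\mathbf{A}_ix_i)\mathbf{G}]$, $q_i(\mu,\mathbf{G})=\min_{x_i\in X_i}L_i(x_i,\mu,\mathbf{G})$, $q=\sum_{i\in V}q_i$. Let $L=\max_{i\in V}\max_{x_i\in X_i}|g_i(x_i)|$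 and $Q=\max_{i\in V}\max_{x_i\in X_i}\|-\mathbf{A}_0/n-\mathbf{A}_ix_i\|_{\mathrm F}$. Consensus-matrix conditions. $\mathbf{W}\in\mathbb{R}^{n\times n}$ satisfies $[\mathbf{W}]_{ij}=0$ if $j\notin N_i\cup\{i\}$, $\mathbf{W}=\mathbf{W}^{\mathsf T}$, $\mathbf{W}\mathbf{1}_n=\mathbf{1}_n$ (with $\mathbf{1}_n$ the all-ones column vector), and the spectral radius of $\mathbf{W}-\mathbf{1}_n\mathbf{1}_n^{\mathsf T}/n$ is at most $\nu$, where $\nu<1$ (and $\nu>0$). Algorithm CoBa-DD. Fix $\alpha>0$, a number $\varphi\in\mathbb{N}$ of consensus steps, a Slater vector $\bar{\mathbf{x}}$, some $\tilde\mu\ge0,\tilde{\mathbf{G}}\succeq0$, set $\gamma=\min\{-\sum_i g_i(\bar x_i),\ \lambda_{\min}(\mathbf{A}_0+\sum_i\mathbf{A}_i\bar x_i)\}$ with $\lambda_{\min}$ the smallest eigenvalue, choose $r\ge (f(\bar{\mathbf{x}})-q(\tilde\mu,\tilde{\mathbf{G}}))/\gamma$, $r>0$, and let $D_\mu=\{\mu\ge0:|\mu|\le (f(\bar{\mathbf{x}})-q(\tilde\mu,\tilde{\mathbf{G}}))/\gamma+r\}$, $D_{\mathbf{G}}=\{\mathbf{G}\succeq0:\|\mathbf{G}\|_{\mathrm F}\le (f(\bar{\mathbf{x}})-q(\tilde\mu,\tilde{\mathbf{G}}))/\gamma+r\}$. Start from $\mu_i^0\in\mathbb{R}_+$, $\mathbf{G}_i^0\in\mathbb{S}_+^d$.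 For $k\ge0$ pick $\tilde x_i^k\in\mathrm{argmin}_{x_i\in X_i}L_i(x_i,\mu_i^k,\mathbf{G}_i^k)$, and update, with $\mathsf{P}_D$ the Euclidean (Frobenius) projection onto $D$, $$\mu_i^{k+1}=\mathsf{P}_{D_\mu}\Big[\sum_{j\in V}[\mathbf{W}^\varphi]_{ij}(\mu_j^k+\alpha g_j(\tilde x_j^k))\Big],\quad \mathbf{G}_i^{k+1}=\mathsf{P}_{D_{\mathbf{G}}}\Big[\sum_{j\in V}[\mathbf{W}^\varphi]_{ij}\big(\mathbf{G}_j^k-\alpha(\mathbf{A}_0/n+\mathbf{A}_j\tilde x_j^k)\big)\Big].$$ For $k\ge1$ the recovered primal vector $\mathbf{x}^k$ has components $x_i^k=\frac1k\sum_{t=1}^k\tilde x_i^t$. Constants $\Lambda,\Gamma$. $\Lambda,\Gamma<\infty$ are such that $\|\mu_i^k\|_2\le\Lambda$ and $\|\mathbf{G}_i^k\|_{\mathrm F}\le\Gamma$ for all $i\in V$, $k\ge0$, and also $|\mu|\le\Lambda$ for all $\mu\in D_\mu$ and $\|\mathbf{G}\|_{\mathrm F}\le\Gamma$ for all $\mathbf{G}\in D_{\mathbf{G}}$. Constant $c_0$. $c_0\ge0$ is a number such that for all $i\in V$ $$\Big\|\sum_{j\in V}[\mathbf{W}^\varphi-\mathbf{1}_n\mathbf{1}_n^{\mathsf T}/n]_{ij}(\mu_j^0+\alpha g_j(\tilde x_j^0))\Big\|_2+\Big\|\sum_{j\in V}[\mathbf{W}^\varphi-\mathbf{1}_n\mathbf{1}_n^{\mathsf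 T}/n]_{ij}\big(\mathbf{G}_j^0-\alpha(\mathbf{A}_0/n+\mathbf{A}_j\tilde x_j^0)\big)\Big\|_{\mathrm F}\le c_0.$$ It is understood that $\beta_0>0$ and $M>0$, so that the logarithms are defined. Scalar $\zeta$. Let $Z=\{(\mu,\mathrm{vec}(\mathbf{G})^{\mathsf T})^{\mathsf T}\in\mathbb{R}^{1+d^2}:\mu\in D_\mu,\mathbf{G}\in D_{\mathbf{G}}\}$ (convex, compact) and write $q(\mathbf{z})=q(\mu,\mathbf{G})$ for $\mathbf{z}=(\mu,\mathrm{vec}(\mathbf{G})^{\mathsf T})^{\mathsf T}$; $q$ is concave. For $\epsilon\ge0$, $\partial_\epsilon q(\mathbf{z}')$ is the set of vectors $\mathbf{g}$ with $\langle\mathbf{g},\mathbf{y}-\mathbf{z}'\rangle\ge q(\mathbf{y})-q(\mathbf{z}')-\epsilon$ for all $\mathbf{y}\in Z$; $\partial q=\partial_0 q$. Given $\tau$, $\zeta>0$ is a finite scalar such that for all $\mathbf{z}\in Z$, all $\mathbf{g}\in\partial q(\mathbf{z})$ and all vectors $\boldsymbol{\nu}\in\mathbb{R}^{1+d^2}$ with $\|\boldsymbol{\nu}\|_2\le\tau$, one has $\mathbf{g}+\boldsymbol{\nu}\in\partial_\zeta q(\mathbf{z})$. *)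

theory Defs
  imports "HOL-Analysis.Analysis"
begin

section \<open>Matrices\<close>

text \<open>
  On \<open>real ^ 'd ^ 'd\<close> the library's \<^const>\<open>norm\<close> is the Frobenius norm and its inner product is
  the trace inner product.  In contrast, \<open>*\<close> and \<open>^\<close> on this type act entrywise, so powers
  with respect to the matrix product \<^const>\<open>matrix_matrix_mult\<close> are introduced separately.
\<close>

definition symmetric_mat :: "real ^ 'd ^ 'd \<Rightarrow> bool" where
  "symmetric_mat M \<longleftrightarrow> transpose M = M"

definition psd :: "real ^ 'd ^ 'd \<Rightarrow> bool" where
  "psd M \<longleftrightarrow> symmetric_mat M \<and> (\<forall>v. 0 \<le> v \<bullet> (M *v v))"

definition posdef :: "real ^ 'd ^ 'd \<Rightarrow> bool" where
  "posdef M \<longleftrightarrow> symmetric_mat M \<and> (\<forall>v. v \<noteq> 0 \<longrightarrow> 0 < v \<bullet> (M *v v))"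

text \<open>Used for symmetric matrices only, whose set of real eigenvalues is finite and nonempty.\<close>

definition lambda_min :: "real ^ 'd ^ 'd \<Rightarrow> real" where
  "lambda_min M = Inf {c. \<exists>v. v \<noteq> 0 \<and> M *v v = c *s v}"

definition mat_power :: "real ^ 'n ^ 'n \<Rightarrow> nat \<Rightarrow> real ^ 'n ^ 'n" where
  "mat_power M k = ((**) M ^^ k) (mat 1)"

text \<open>The spectral radius takes all complex eigenvalues of the real matrix into account.\<close>

definition spectral_radius :: "real ^ 'n ^ 'n \<Rightarrow> real" where
  "spectral_radius M =
     Sup {cmod c | c. \<exists>v :: complex ^ 'n. v \<noteq> 0 \<and> map_matrix complex_of_real M *v v = c *s v}"

text \<open>The averaging matrix $\mathbf{1}_n\mathbf{1}_n^{\mathsf T}/n$.\<close>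

definition avg_mat :: "real ^ 'n ^ 'n" where
  "avg_mat = (\<chi> i j. 1 / real CARD('n))"

section \<open>The coupled problem and its dual\<close>

text \<open>
  The node set is the finite type \<open>'v\<close>, so $n$ is \<open>CARD('v)\<close>; matrices are indexed by the
  finite type \<open>'d\<close>, so $d$ is \<open>CARD('d)\<close>.
\<close>

record ('v, 'd :: finite) coupled_problem =
  cost :: "'v \<Rightarrow> real \<Rightarrow> real"
  constr :: "'v \<Rightarrow> real \<Rightarrow> real"
  local_set :: "'v \<Rightarrow> real set"
  mat0 :: "real ^ 'd ^ 'd"
  mats :: "'v \<Rightarrow> real ^ 'd ^ 'd"

definition convex_problem :: "('v :: finite, 'd :: finite) coupled_problem \<Rightarrow> bool" where
  "convex_problem P \<longleftrightarrow>
     (\<forall>i. convex_on UNIV (cost P i) \<and> convex_on UNIV (constr P i) \<and>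
          convex (local_set P i) \<and> compact (local_set P i) \<and> symmetric_mat (mats P i)) \<and>
     symmetric_mat (mat0 P)"

definition total_cost :: "('v :: finite, 'd :: finite) coupled_problem \<Rightarrow> real ^ 'v \<Rightarrow> real" where
  "total_cost P x = (\<Sum>i\<in>UNIV. cost P i (x $ i))"

definition total_constr :: "('v :: finite, 'd :: finite) coupled_problem \<Rightarrow> real ^ 'v \<Rightarrow> real" where
  "total_constr P x = (\<Sum>i\<in>UNIV. constr P i (x $ i))"

definition lmi :: "('v :: finite, 'd :: finite) coupled_problem \<Rightarrow> real ^ 'v \<Rightarrow> real ^ 'd ^ 'd" where
  "lmi P x = mat0 P + (\<Sum>i\<in>UNIV. (x $ i) *\<^sub>R mats P i)"

definition product_set :: "('v :: finite, 'd :: finite) coupled_problem \<Rightarrow> (real ^ 'v) set" where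
  "product_set P = {x. \<forall>i. x $ i \<in> local_set P i}"

definition feasible_set :: "('v :: finite, 'd :: finite) coupled_problem \<Rightarrow> (real ^ 'v) set" where
  "feasible_set P = {x \<in> product_set P. total_constr P x \<le> 0 \<and> psd (lmi P x)}"

text \<open>
  The costs are real valued, so the requirements that the objective be nowhere minus infinity and
  somewhere finite on the feasible set reduce to nonemptiness of \<open>feasible_set\<close>.
\<close>

definition opt_value :: "('v :: finite, 'd :: finite) coupled_problem \<Rightarrow> real" where
  "opt_value P = (INF x\<in>feasible_set P. total_cost P x)"

definition slater_vector :: "('v :: finite, 'd :: finite) coupled_problem \<Rightarrow> real ^ 'v \<Rightarrow> bool" where
  "slater_vector P x \<longleftrightarrow> x \<in> product_set P \<and> total_constr P x < 0 \<and> posdef (lmi P x)"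

definition local_mat ::
    "('v :: finite, 'd :: finite) coupled_problem \<Rightarrow> 'v \<Rightarrow> real \<Rightarrow> real ^ 'd ^ 'd" where
  "local_mat P i t = (1 / real CARD('v)) *\<^sub>R mat0 P + t *\<^sub>R mats P i"

definition local_lagrangian ::
    "('v :: finite, 'd :: finite) coupled_problem \<Rightarrow> 'v \<Rightarrow> real \<Rightarrow> real \<Rightarrow> real ^ 'd ^ 'd \<Rightarrow> real" where
  "local_lagrangian P i t \<mu> G = cost P i t + \<mu> * constr P i t - trace (local_mat P i t ** G)"

definition local_dual ::
    "('v :: finite, 'd :: finite) coupled_problem \<Rightarrow> 'v \<Rightarrow> real \<Rightarrow> real ^ 'd ^ 'd \<Rightarrow> real" where
  "local_dual P i \<mu> G = (INF t\<in>local_set P i. local_lagrangian P i t \<mu> G)"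

definition dual_fun ::
    "('v :: finite, 'd :: finite) coupled_problem \<Rightarrow> real \<Rightarrow> real ^ 'd ^ 'd \<Rightarrow> real" where
  "dual_fun P \<mu> G = (\<Sum>i\<in>UNIV. local_dual P i \<mu> G)"

definition bound_L :: "('v :: finite, 'd :: finite) coupled_problem \<Rightarrow> real" where
  "bound_L P = (MAX i. SUP t\<in>local_set P i. \<bar>constr P i t\<bar>)"

definition bound_Q :: "('v :: finite, 'd :: finite) coupled_problem \<Rightarrow> real" where
  "bound_Q P = (MAX i. SUP t\<in>local_set P i. norm (- local_mat P i t))"

text \<open>
  \<open>multiplier_bound\<close> is the bound $(f(\bar{x}) - q(\tilde\mu,\tilde G))/\gamma$ on the optimal
  multipliers that results from the Slater vector $\bar{x}$.
\<close>

definition slater_gap :: "('v :: finite, 'd :: finite) coupled_problem \<Rightarrow> real ^ 'v \<Rightarrow> real" where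
  "slater_gap P xbar = min (- total_constr P xbar) (lambda_min (lmi P xbar))"

definition multiplier_bound ::
    "('v :: finite, 'd :: finite) coupled_problem \<Rightarrow> real ^ 'v \<Rightarrow> real \<Rightarrow> real ^ 'd ^ 'd \<Rightarrow> real" where
  "multiplier_bound P xbar \<mu> G = (total_cost P xbar - dual_fun P \<mu> G) / slater_gap P xbar"

definition D_mu :: "real \<Rightarrow> real set" where
  "D_mu R = {\<mu>. 0 \<le> \<mu> \<and> \<bar>\<mu>\<bar> \<le> R}"

definition D_G :: "real \<Rightarrow> (real ^ 'd ^ 'd) set" where
  "D_G R = {G. psd G \<and> norm G \<le> R}"

text \<open>
  The \<open>\<epsilon>\<close>-subdifferential, relative to \<open>Z\<close>, of a concave function.  It is used with the Euclidean
  space \<open>real \<times> real ^ 'd ^ 'd\<close> in place of $\mathbb{R}^{1+d^2}$; the two are identified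
  isometrically by $(\mu, G) \mapsto (\mu, \mathrm{vec}(G)^{\mathsf T})^{\mathsf T}$.
\<close>

definition eps_subdiff :: "('a :: real_inner \<Rightarrow> real) \<Rightarrow> 'a set \<Rightarrow> real \<Rightarrow> 'a \<Rightarrow> 'a set" where
  "eps_subdiff q Z \<epsilon> z = {g. \<forall>y\<in>Z. g \<bullet> (y - z) \<ge> q y - q z - \<epsilon>}"

section \<open>The algorithm\<close>

text \<open>\<open>E\<close> is the edge relation of the graph; the neighbours of \<open>i\<close> are \<open>E `` {i}\<close>.\<close>

definition consensus_matrix :: "('v :: finite) rel \<Rightarrow> real \<Rightarrow> real ^ 'v ^ 'v \<Rightarrow> bool" where
  "consensus_matrix E \<nu> W \<longleftrightarrow>
     (\<forall>i j. j \<notin> E `` {i} \<union> {i} \<longrightarrow> W $ i $ j = 0) \<and>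
     W = transpose W \<and>
     W *v 1 = 1 \<and>
     spectral_radius (W - avg_mat) \<le> \<nu>"

text \<open>
  Iterates are written \<open>\<mu> k i\<close>, \<open>G k i\<close>, \<open>xt k i\<close> for $\mu_i^k$, $G_i^k$, $\tilde x_i^k$.
  The \<open>local_*_step\<close> functions are the quantities mixed by the consensus matrix.
\<close>

definition local_mu_step ::
    "('v :: finite, 'd :: finite) coupled_problem \<Rightarrow> real \<Rightarrow> ('v \<Rightarrow> real) \<Rightarrow> ('v \<Rightarrow> real) \<Rightarrow> 'v \<Rightarrow> real" where
  "local_mu_step P \<alpha> \<mu> xt j = \<mu> j + \<alpha> * constr P j (xt j)"

definition local_G_step ::
    "('v :: finite, 'd :: finite) coupled_problem \<Rightarrow> real \<Rightarrow> ('v \<Rightarrow> real ^ 'd ^ 'd) \<Rightarrow>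
     ('v \<Rightarrow> real) \<Rightarrow> 'v \<Rightarrow> real ^ 'd ^ 'd" where
  "local_G_step P \<alpha> G xt j = G j - \<alpha> *\<^sub>R local_mat P j (xt j)"

definition coba_dd ::
    "('v :: finite, 'd :: finite) coupled_problem \<Rightarrow> real ^ 'v ^ 'v \<Rightarrow> nat \<Rightarrow> real \<Rightarrow> real \<Rightarrow>
     (nat \<Rightarrow> 'v \<Rightarrow> real) \<Rightarrow> (nat \<Rightarrow> 'v \<Rightarrow> real ^ 'd ^ 'd) \<Rightarrow> (nat \<Rightarrow> 'v \<Rightarrow> real) \<Rightarrow> bool" where
  "coba_dd P W \<phi> \<alpha> R \<mu> G xt \<longleftrightarrow>
     (\<forall>i. 0 \<le> \<mu> 0 i \<and> psd (G 0 i)) \<and>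
     (\<forall>k i. is_arg_min (\<lambda>t. local_lagrangian P i t (\<mu> k i) (G k i))
              (\<lambda>t. t \<in> local_set P i) (xt k i)) \<and>
     (\<forall>k i. \<mu> (Suc k) i = closest_point (D_mu R)
              (\<Sum>j\<in>UNIV. mat_power W \<phi> $ i $ j * local_mu_step P \<alpha> (\<mu> k) (xt k) j)) \<and>
     (\<forall>k i. G (Suc k) i = closest_point (D_G R)
              (\<Sum>j\<in>UNIV. (mat_power W \<phi> $ i $ j) *\<^sub>R local_G_step P \<alpha> (G k) (xt k) j))"

definition recovered_primal :: "(nat \<Rightarrow> ('v :: finite) \<Rightarrow> real) \<Rightarrow> nat \<Rightarrow> real ^ 'v" where
  "recovered_primal xt k = (\<chi> i. (1 / real k) * (\<Sum>t=1..k. xt t i))"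

end

theory Submission
  imports Defs
begin

text \<open>
  Put $z_i^k = (\mu_i^k, G_i^k)$ and let $g_i^k = (g_i(\tilde x_i^k), -A_0/n - A_i \tilde x_i^k)$, a
  supergradient of $q_i$ at $z_i^k$.  Comparing with the point $v^{k+1}$ obtained by projecting the
  exact average of the $z_i^k + \alpha g_i^k$, the choice of $\varphi$ gives by induction
  $\|z_i^k - v^k\| \le \beta_0$ for $k \ge 1$.  Hence $v^k$ follows a projected supergradient
  iteration with step $\alpha / n$ whose direction is $\sum_i g_i^k$ up to an error of norm at most
  $n \tau$, and the usual telescoping estimate bounds the average of the direction paired with
  $w - v^k$ for every $w \in Z$.  Taking $w = 0$ with weak duality yields the upper bound; taking
  $w = 2 z^*$ for a Slater multiplier $z^*$ yields the lower one, the pairing of two points of $Z$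
  being nonnegative.
\<close>

text \<open>Each minimiser is computed at its node's own dual point, so the minimal Lagrangian
  values refer to n different points. Both a local dual function and the pairing with a
  supergradient are \<open>M\<close>-Lipschitz in the dual point, so moving each of them to the
  common center v costs \<open>M * \<beta>0\<close> per node. With F the summed cost of the
  minimisers, g the summed supergradient, f* the optimal value and c = 2 n M
  \<open>\<beta>0\<close>, this gives F + g.v <= f* + c. The averaged primal vector may be
  infeasible, so f* bounds its cost from below only up to a penalty, at most the average of g.w for
  a Slater multiplier w. Comparing the iteration with w itself controls only g.(w - v), not g.w. But
  f* <= F + g.w yields g.v <= g.w + c, hence g.w <= g.(2 w - v) + c. This is why the comparison
  point is doubled and why the radius of the dual sets has to reach twice the multiplier
  bound.\<close>

section \<open>Symmetric and positive semidefinite matrices\<close>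

lemma symmetric_mat_component: "symmetric_mat A \<Longrightarrow> A $ i $ j = A $ j $ i"
  unfolding symmetric_mat_def transpose_def by (metis vec_lambda_beta)

lemma symmetric_mat_inner:
  assumes "symmetric_mat A" shows "u \<bullet> (A *v v) = (A *v u) \<bullet> v"
  using assms unfolding symmetric_mat_def
  by (metis dot_lmul_matrix transpose_matrix_vector)

text \<open>The rank one matrix of \<open>v\<close>. Pairing with it makes the quadratic form at
  \<open>v\<close> a linear functional of the matrix, which serves for closedness of the cone and
  for testing multipliers.\<close>

definition outer :: "real ^ 'd \<Rightarrow> real ^ 'd ^ 'd" where
  "outer v = (\<chi> i j. v $ i * v $ j)"

lemma inner_outer: "outer v \<bullet> H = v \<bullet> (H *v v)"
  by (simp add: outer_def inner_vec_def matrix_vector_mult_def sum_distrib_left mult_ac)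

lemma outer_mult: "outer w *v v = (w \<bullet> v) *\<^sub>R w"
  by (simp add: vec_eq_iff outer_def matrix_vector_mult_def inner_vec_def sum_distrib_left mult_ac)

lemma outer_quadratic: "v \<bullet> (outer w *v v) = (w \<bullet> v)\<^sup>2"
  by (simp add: outer_mult inner_commute power2_eq_square)

lemma symmetric_outer: "symmetric_mat (outer v)"
  by (simp add: symmetric_mat_def outer_def transpose_def vec_eq_iff mult.commute)

lemma quadratic_axis: "axis i 1 \<bullet> (A *v axis i 1) = A $ i $ i" for A :: "real ^ 'd ^ 'd"
  by (simp add: inner_axis' matrix_vector_mult_basis column_def)

text \<open>Cauchy-Schwarz for the possibly degenerate form of \<open>A\<close>: the form is
  nonnegative on the span of \<open>u\<close> and \<open>v\<close>. If \<open>c\<close> is nonzero,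
  the coefficients (c, b) give c (c a - b^2); if \<open>c = 0\<close>, the coefficients (b, a + 1)
  give - b^2 (a + 2), which forces \<open>b = 0\<close>.\<close>

lemma inner_le_sqrt_quadratic:
  assumes "psd A" shows "(u \<bullet> (A *v v))\<^sup>2 \<le> (u \<bullet> (A *v u)) * (v \<bullet> (A *v v))"
proof -
  define a b c where abc: "a = u \<bullet> (A *v u)" "b = u \<bullet> (A *v v)" "c = v \<bullet> (A *v v)"
  have sym: "v \<bullet> (A *v u) = b"
    using assms abc symmetric_mat_inner psd_def by (metis inner_commute)
  have "0 \<le> (s *\<^sub>R u - t *\<^sub>R v) \<bullet> (A *v (s *\<^sub>R u - t *\<^sub>R v))" for s t
    using assms by (simp add: psd_def)
  also have "(s *\<^sub>R u - t *\<^sub>R v) \<bullet> (A *v (s *\<^sub>R u - t *\<^sub>R v)) = s\<^sup>2 * a - 2 * s * t * b + t\<^sup>2 * c" for s t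
    by (simp add: abc[symmetric] sym matrix_vector_mult_diff_distrib matrix_vector_mult_scaleR
        inner_diff_left inner_diff_right algebra_simps power2_eq_square)
  finally have q: "0 \<le> s\<^sup>2 * a - 2 * s * t * b + t\<^sup>2 * c" for s t .
  have ac: "0 \<le> a" "0 \<le> c" using assms abc by (auto simp: psd_def)
  show ?thesis
  proof (cases "c = 0")
    case True
    have "b = 0"
    proof (rule ccontr)
      assume "b \<noteq> 0"
      have "0 \<le> b\<^sup>2 * a - 2 * b * (a + 1) * b" using q[of b "(a + 1)"] True by simp
      also have "\<dots> = - (b\<^sup>2 * (a + 2))" by (simp add: algebra_simps power2_eq_square)
      finally have "b\<^sup>2 * (a + 2) \<le> 0" by simp
      moreover have "0 < b\<^sup>2 * (a + 2)" using ac \<open>b \<noteq> 0\<close> by (intro mult_pos_pos) auto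
      ultimately show False by linarith
    qed
    then show ?thesis by (simp add: abc[symmetric] True)
  next
    case False
    have "0 \<le> c * (c * a - b\<^sup>2)"
      using q[of c b] by (simp add: algebra_simps power2_eq_square)
    then have "0 \<le> c * a - b\<^sup>2" using False ac by (simp add: zero_le_mult_iff)
    then show ?thesis by (simp add: abc[symmetric] mult.commute)
  qed
qed

lemma psd_component_sq_le:
  assumes "psd A" shows "(A $ i $ j)\<^sup>2 \<le> A $ i $ i * A $ j $ j"
  using inner_le_sqrt_quadratic[OF assms, of "axis i 1" "axis j 1"]
  by (simp add: quadratic_axis) (simp add: inner_axis' matrix_vector_mult_basis column_def)

lemma psd_diag: "psd A \<Longrightarrow> 0 \<le> A $ i $ i"
  by (metis quadratic_axis psd_def)

text \<open>The 2 by 2 minors bound every entry by diagonal ones. In particular a zero diagonal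
  forces the zero matrix, which is the base case of the elimination below.\<close>

lemma psd_norm_le_trace:
  assumes "psd A" shows "norm A \<le> trace A"
proof -
  have "(norm A)\<^sup>2 = (\<Sum>i\<in>UNIV. \<Sum>j\<in>UNIV. (A $ i $ j)\<^sup>2)"
    unfolding power2_norm_eq_inner by (simp add: inner_vec_def power2_eq_square)
  also have "\<dots> \<le> (\<Sum>i\<in>UNIV. \<Sum>j\<in>UNIV. A $ i $ i * A $ j $ j)"
    by (intro sum_mono psd_component_sq_le assms)
  also have "\<dots> = (trace A)\<^sup>2"
    by (simp add: trace_def power2_eq_square sum_product)
  finally show ?thesis
    by (rule power2_le_imp_le) (simp add: trace_def sum_nonneg psd_diag assms)
qed

text \<open>Cholesky elimination: subtracting the outer product of a column, scaled by its diagonal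
  entry, clears one more diagonal entry and keeps the matrix positive semidefinite.\<close>

lemma psd_inner_nonneg:
  assumes "psd A" and H: "\<And>v. 0 \<le> v \<bullet> (H *v v)"
  shows "0 \<le> A \<bullet> H"
  using assms(1)
proof (induction "card {i. A $ i $ i \<noteq> 0}" arbitrary: A rule: less_induct)
  case less
  show ?case
  proof (cases "\<exists>i. A $ i $ i \<noteq> 0")
    case False
    then have "norm A \<le> 0" using psd_norm_le_trace[OF less.prems] by (simp add: trace_def)
    then show ?thesis by simp
  next
    case True
    then obtain i where i: "A $ i $ i \<noteq> 0" by blast
    define a where "a = A $ i $ i"
    have a: "0 < a" using i psd_diag[OF less.prems, of i] a_def by simp
    define w where "w = A *v axis i 1"
    define A' where "A' = A - (1 / a) *\<^sub>R outer w"
    have w: "w $ j = A $ i $ j" for j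
      using symmetric_mat_component[of A j i] less.prems
      by (simp add: w_def matrix_vector_mult_basis column_def psd_def)
    have "psd A'"
      unfolding psd_def
    proof (intro conjI allI)
      show "symmetric_mat A'"
        using less.prems symmetric_outer[of w]
        by (simp add: psd_def symmetric_mat_def A'_def transpose_def vec_eq_iff)
      fix v
      have wv: "w \<bullet> v = v \<bullet> (A *v axis i 1)" by (simp add: w_def inner_commute)
      have "(w \<bullet> v)\<^sup>2 \<le> (v \<bullet> (A *v v)) * a"
        using inner_le_sqrt_quadratic[OF less.prems, of v "axis i 1"]
        by (simp add: wv quadratic_axis a_def)
      then have "(w \<bullet> v)\<^sup>2 / a \<le> v \<bullet> (A *v v)" using a by (simp add: field_simps)
      then show "0 \<le> v \<bullet> (A' *v v)"
        by (simp add: A'_def matrix_vector_mult_diff_rdistrib inner_diff_right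
            scaleR_matrix_vector_assoc[symmetric] outer_quadratic)
    qed
    moreover have "card {j. A' $ j $ j \<noteq> 0} < card {j. A $ j $ j \<noteq> 0}"
    proof (rule psubset_card_mono)
      have "A' $ i $ i = 0" using a by (simp add: A'_def outer_def w a_def power2_eq_square)
      \<comment> \<open>A diagonal entry that is already zero stays zero: by the minor inequality
        the whole column of \<open>A\<close> at \<open>j\<close> vanishes, so \<open>w\<close> has
        no component there.\<close>
      moreover have "A' $ j $ j = 0" if "A $ j $ j = 0" for j
        using psd_component_sq_le[OF less.prems, of i j] that by (simp add: A'_def outer_def w)
      ultimately show "{j. A' $ j $ j \<noteq> 0} \<subset> {j. A $ j $ j \<noteq> 0}" using i by auto
    qed simp
    ultimately have "0 \<le> A' \<bullet> H" using less.hyps by blast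
    moreover have "A \<bullet> H = A' \<bullet> H + (w \<bullet> (H *v w)) / a"
      by (simp add: A'_def inner_diff_left inner_outer)
    ultimately show ?thesis using H[of w] a by simp
  qed
qed

lemma convex_psd: "convex {A. psd A}"
  unfolding convex_def
proof (clarsimp simp: psd_def, intro conjI allI)
  fix A B :: "real ^ 'd ^ 'd" and u v :: real
  assume *: "symmetric_mat A" "symmetric_mat B"
  then show "symmetric_mat (u *\<^sub>R A + v *\<^sub>R B)"
    by (simp add: symmetric_mat_def transpose_def vec_eq_iff)
qed (simp add: matrix_vector_mult_add_rdistrib inner_add_right scaleR_matrix_vector_assoc[symmetric])

lemma closed_psd: "closed {A :: real ^ 'd ^ 'd. psd A}"
proof -
  have *: "{A :: real ^ 'd ^ 'd. psd A} =
    (\<Inter>i. \<Inter>j. {A. A $ i $ j = A $ j $ i}) \<inter> (\<Inter>v. {A. 0 \<le> outer v \<bullet> A})"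
    by (auto simp: psd_def symmetric_mat_def transpose_def vec_eq_iff inner_outer)
  show ?thesis
    unfolding * by (intro closed_Int closed_INT ballI closed_Collect_eq closed_Collect_le)
      (intro continuous_intros)+
qed

lemma psd_scaleR: "psd A \<Longrightarrow> 0 \<le> c \<Longrightarrow> psd (c *\<^sub>R A)"
  by (auto simp: psd_def symmetric_mat_def transpose_scalar scaleR_matrix_vector_assoc[symmetric])

lemma psd_0: "psd 0"
  by (simp add: psd_def symmetric_mat_def transpose_def vec_eq_iff)

lemma psd_mat1: "psd (mat 1)"
  by (simp add: psd_def symmetric_mat_def)

lemma psd_posdef: "posdef A \<Longrightarrow> psd A"
  unfolding psd_def posdef_def by (metis inner_zero_left less_eq_real_def)

lemma trace_mult_symmetric:
  assumes "symmetric_mat G" shows "trace (A ** G) = A \<bullet> G"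
  by (simp add: trace_def matrix_matrix_mult_def inner_vec_def symmetric_mat_component[OF assms])

section \<open>Extremal eigenvalues and the spectral radius\<close>

text \<open>The minimum of the Rayleigh quotient is attained and is an eigenvalue; this identifies it
  with the infimum of the eigenvalues.\<close>

lemma lambda_min_attained:
  assumes "symmetric_mat A"
  obtains u where "norm u = 1" "u \<bullet> (A *v u) = lambda_min A" "\<And>v. lambda_min A * (v \<bullet> v) \<le> v \<bullet> (A *v v)"
proof -
  have "compact (sphere (0 :: real ^ 'd) 1)" by simp
  moreover have "sphere (0 :: real ^ 'd) 1 \<noteq> {}" by simp
  moreover have "continuous_on (sphere 0 1) (\<lambda>v. v \<bullet> (A *v v))"
    by (intro continuous_intros linear_continuous_on) auto
  ultimately obtain u where u: "u \<in> sphere 0 1" "\<And>v. v \<in> sphere 0 1 \<Longrightarrow> u \<bullet> (A *v u) \<le> v \<bullet> (A *v v)"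
    using continuous_attains_inf[of "sphere 0 1" "\<lambda>v. v \<bullet> (A *v v)"] by blast
  define m where "m = u \<bullet> (A *v u)"
  have uu: "u \<bullet> u = 1" "norm u = 1" using u(1) by (auto simp: norm_eq_1)
  have m: "m * (v \<bullet> v) \<le> v \<bullet> (A *v v)" for v
  proof (cases "v = 0")
    case False
    have "m \<le> (v /\<^sub>R norm v) \<bullet> (A *v (v /\<^sub>R norm v))" using u(2)[of "v /\<^sub>R norm v"] False m_def by simp
    also have "\<dots> = (v \<bullet> (A *v v)) / (v \<bullet> v)"
      by (simp add: matrix_vector_mult_scaleR power2_norm_eq_inner[symmetric] power2_eq_square field_simps)
    finally show ?thesis using False by (simp add: field_simps)
  qed simp
  \<comment> \<open>The shifted matrix is positive semidefinite and its form vanishes at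
    \<open>u\<close>; Cauchy-Schwarz against \<open>C *v u\<close> then forces
    \<open>C *v u = 0\<close>, so the minimiser is an eigenvector.\<close>
  define C where "C = A - m *\<^sub>R mat 1"
  have Cv: "C *v v = A *v v - m *\<^sub>R v" for v
    by (simp add: C_def matrix_vector_mult_diff_rdistrib scaleR_matrix_vector_assoc[symmetric])
  have "psd C"
    unfolding psd_def
  proof (intro conjI allI)
    show "symmetric_mat C"
      using assms by (simp add: C_def symmetric_mat_def transpose_def vec_eq_iff mat_def)
    show "0 \<le> v \<bullet> (C *v v)" for v using m[of v] by (simp add: Cv inner_diff_right)
  qed
  moreover have "u \<bullet> (C *v u) = 0" by (simp add: Cv inner_diff_right uu m_def)
  ultimately have "((C *v u) \<bullet> (C *v u))\<^sup>2 \<le> 0"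
    using inner_le_sqrt_quadratic[of C "C *v u" u] by simp
  then have "A *v u = m *s u" by (simp add: Cv scalar_mult_eq_scaleR)
  moreover have "u \<noteq> 0" using uu by auto
  moreover have "m \<le> c" if "v \<noteq> 0" "A *v v = c *s v" for c v
    using m[of v] that by (simp add: scalar_mult_eq_scaleR)
  ultimately have "lambda_min A = m"
    unfolding lambda_min_def by (intro cInf_eq_minimum) auto
  then show ?thesis using that uu m m_def by metis
qed

lemma posdef_lambda_min_pos:
  assumes "posdef A" shows "0 < lambda_min A"
proof -
  obtain u where "norm u = 1" "u \<bullet> (A *v u) = lambda_min A"
    using assms by (auto simp: posdef_def intro: lambda_min_attained[of A])
  moreover have "u \<noteq> 0" using \<open>norm u = 1\<close> by auto
  ultimately show ?thesis using assms by (auto simp: posdef_def)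
qed

text \<open>Pairing \<open>G\<close> with the positive semidefinite matrix A - lambda I gives the
  bound with the trace of \<open>G\<close>, which dominates the Frobenius norm. This is how the
  eigenvalue part of the Slater gap controls the matrix multiplier.\<close>

lemma lambda_min_norm_le_inner:
  assumes A: "symmetric_mat A" "0 \<le> lambda_min A" and G: "psd G"
  shows "lambda_min A * norm G \<le> G \<bullet> A"
proof -
  have "0 \<le> G \<bullet> (A - lambda_min A *\<^sub>R mat 1)"
    using G
  proof (rule psd_inner_nonneg)
    fix v
    have "lambda_min A * (v \<bullet> v) \<le> v \<bullet> (A *v v)" by (rule lambda_min_attained[OF A(1)])
    then show "0 \<le> v \<bullet> ((A - lambda_min A *\<^sub>R mat 1) *v v)"
      by (simp add: matrix_vector_mult_diff_rdistrib scaleR_matrix_vector_assoc[symmetric] inner_diff_right)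
  qed
  moreover have "G \<bullet> mat 1 = trace G"
    by (simp add: inner_vec_def mat_def trace_def if_distrib cong: if_cong)
  ultimately have "lambda_min A * trace G \<le> G \<bullet> A" by (simp add: inner_diff_right)
  then show ?thesis
    using psd_norm_le_trace[OF G] A(2) by (meson mult_left_mono order_trans)
qed

text \<open>A maximiser of \<open>norm (B *v x)\<close> on the sphere is an eigenvector of \<open>B ** B\<close> for \<open>m\<^sup>2\<close>, so \<open>B\<close>
  has the eigenvalue \<open>m\<close> or \<open>-m\<close>.\<close>

lemma symmetric_norm_attained_eigenvalue:
  fixes B :: "real ^ 'n ^ 'n"
  assumes B: "symmetric_mat B"
  obtains v c where "v \<noteq> 0" "B *v v = c *s v" "\<And>x. norm (B *v x) \<le> \<bar>c\<bar> * norm x"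
proof -
  have "compact (sphere (0 :: real ^ 'n) 1)" by simp
  moreover have "sphere (0 :: real ^ 'n) 1 \<noteq> {}" by simp
  moreover have "continuous_on (sphere 0 1) (\<lambda>v. norm (B *v v))"
    by (intro continuous_intros linear_continuous_on) auto
  ultimately obtain u where u: "u \<in> sphere 0 1" "\<And>v. v \<in> sphere 0 1 \<Longrightarrow> norm (B *v v) \<le> norm (B *v u)"
    using continuous_attains_sup[of "sphere 0 1" "\<lambda>v. norm (B *v v)"] by blast
  define m where "m = norm (B *v u)"
  have uu: "u \<bullet> u = 1" "u \<noteq> 0" using u(1) by (auto simp: norm_eq_1)
  have m: "norm (B *v v) \<le> m * norm v" for v
  proof (cases "v = 0")
    case False
    then show ?thesis using u(2)[of "v /\<^sub>R norm v"]
      by (simp add: matrix_vector_mult_scaleR m_def field_simps)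
  qed simp
  define w where "w = B *v (B *v u)"
  have "norm w \<le> m * m" using m[of "B *v u"] by (simp add: w_def m_def)
  then have "(norm w)\<^sup>2 \<le> (m * m)\<^sup>2" by (rule power_mono) simp
  moreover have "w \<bullet> u = m * m"
    using symmetric_mat_inner[OF B, of u "B *v u"]
    by (simp add: w_def m_def inner_commute power2_norm_eq_inner[symmetric] power2_eq_square)
  \<comment> \<open>The equality case of Cauchy-Schwarz: the square expands to |w|^2 - 2 m^4 + m^4,
    and |w| is at most m^2.\<close>
  ultimately have "(norm (w - (m * m) *\<^sub>R u))\<^sup>2 \<le> 0"
    unfolding power2_norm_eq_inner
    by (simp add: inner_diff_left inner_diff_right uu inner_commute power2_eq_square)
  then have w: "w = (m * m) *\<^sub>R u" by simp
  \<comment> \<open>Since (B - m)(B + m) u = 0, either x = (B + m) u is an eigenvector for m, or it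
    vanishes and u is one for -m.\<close>
  define x where "x = B *v u + m *\<^sub>R u"
  have "B *v x = m *\<^sub>R x"
    by (simp add: x_def matrix_vector_right_distrib matrix_vector_mult_scaleR w_def[symmetric] w
        scaleR_add_right add.commute)
  have "0 \<le> m" by (simp add: m_def)
  show thesis
  proof (cases "x = 0")
    case True
    then have "B *v u = (- m) *s u" by (simp add: x_def eq_neg_iff_add_eq_0 scalar_mult_eq_scaleR)
    then show ?thesis using that[of u "- m"] m uu \<open>0 \<le> m\<close> by simp
  next
    case False
    then show ?thesis
      using that[of x m] m \<open>0 \<le> m\<close> \<open>B *v x = m *\<^sub>R x\<close> by (simp add: scalar_mult_eq_scaleR)
  qed
qed

text \<open>The extremal real eigenvalue belongs to the complex spectrum through its embedded
  eigenvector. A supremum of reals dominates its members only for a set bounded above; the operator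
  norm of the complexified matrix provides that bound.\<close>

lemma symmetric_norm_le_spectral_radius:
  fixes B :: "real ^ 'n ^ 'n"
  assumes "symmetric_mat B"
  shows "norm (B *v x) \<le> spectral_radius B * norm x"
proof -
  obtain v c where v: "v \<noteq> 0" "B *v v = c *s v" and c: "\<And>x. norm (B *v x) \<le> \<bar>c\<bar> * norm x"
    using symmetric_norm_attained_eigenvalue[OF assms] by metis
  let ?S = "{cmod c | c. \<exists>v :: complex ^ 'n. v \<noteq> 0 \<and> map_matrix complex_of_real B *v v = c *s v}"
  have "\<exists>K. \<forall>v. norm (map_matrix complex_of_real B *v v) \<le> norm v * K"
    by (intro bounded_linear.bounded matrix_vector_mul_bounded_linear)
  then obtain K where K: "\<And>v. norm (map_matrix complex_of_real B *v v) \<le> norm v * K"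
    by auto
  have norm_smult: "norm (c *s v) = cmod c * norm v" for c and v :: "complex ^ 'n"
    by (simp add: norm_vec_def norm_mult L2_set_right_distrib)
  have "bdd_above ?S"
  proof (rule bdd_aboveI)
    fix a assume "a \<in> ?S"
    then obtain c and v :: "complex ^ 'n" where "a = cmod c" "v \<noteq> 0" "map_matrix complex_of_real B *v v = c *s v"
      by blast
    then have "a * norm v \<le> K * norm v" "0 < norm v" using K[of v] norm_smult[of c v] by (auto simp: mult.commute)
    then show "a \<le> K" by simp
  qed
  moreover have "\<bar>c\<bar> \<in> ?S"
  proof -
    define v' :: "complex ^ 'n" where "v' = (\<chi> i. complex_of_real (v $ i))"
    have "v' \<noteq> 0" using v(1) by (auto simp: v'_def vec_eq_iff)
    moreover have "map_matrix complex_of_real B *v v' = complex_of_real c *s v'"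
      using v(2) by (simp add: v'_def vec_eq_iff matrix_vector_mult_def map_matrix_def
          flip: of_real_mult of_real_sum)
    ultimately show ?thesis by (smt (verit, best) mem_Collect_eq norm_of_real)
  qed
  ultimately have "\<bar>c\<bar> \<le> spectral_radius B" unfolding spectral_radius_def by (intro cSup_upper)
  then show ?thesis using c[of x] by (meson mult_right_mono norm_ge_zero order_trans)
qed

section \<open>Mixing of the consensus matrix\<close>

lemma avg_mat_mult: "avg_mat *v x = ((x \<bullet> 1) / real CARD('n)) *\<^sub>R 1" for x :: "real ^ 'n"
  by (simp add: vec_eq_iff avg_mat_def matrix_vector_mult_def inner_vec_def sum_divide_distrib)

lemma inner_one_one: "(1 :: real ^ 'n) \<bullet> 1 = real CARD('n)"
  by (simp add: inner_vec_def)

lemma norm_avg_mat_mult_le: "norm (avg_mat *v x) \<le> norm x" for x :: "real ^ 'n"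
proof -
  have n: "(norm (1 :: real ^ 'n))\<^sup>2 = real CARD('n)"
    by (simp add: power2_norm_eq_inner inner_one_one)
  have "norm (avg_mat *v x) = \<bar>x \<bullet> 1\<bar> / real CARD('n) * norm (1 :: real ^ 'n)"
    by (simp add: avg_mat_mult)
  also have "\<dots> \<le> (norm x * norm (1 :: real ^ 'n)) / real CARD('n) * norm (1 :: real ^ 'n)"
    by (intro mult_right_mono divide_right_mono Cauchy_Schwarz_ineq2) auto
  also have "\<dots> = norm x"
    using n by (simp add: power2_eq_square field_simps)
  finally show ?thesis .
qed

lemma symmetric_avg_mat: "symmetric_mat avg_mat"
  by (simp add: symmetric_mat_def avg_mat_def transpose_def)

lemma mat_power_Suc_mult: "mat_power W (Suc k) *v x = W *v (mat_power W k *v x)"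
  by (simp add: mat_power_def matrix_vector_mul_assoc)

lemma mat_power_one:
  assumes "W *v 1 = 1" shows "mat_power W k *v 1 = 1"
  by (induction k) (simp_all add: mat_power_Suc_mult assms, simp add: mat_power_def)

text \<open>Because W fixes the ones vector and is symmetric, the averaging matrix absorbs W from
  both sides, so W^(k+1) - avg = (W - avg)(W^k - avg), and each new factor contracts by
  \<open>\<nu>\<close>. The factor 2 pays for k = 0, where I - avg is estimated by the triangle
  inequality.\<close>

lemma consensus_power_dev:
  fixes W :: "real ^ 'v ^ 'v"
  assumes W: "consensus_matrix E \<nu> W" and \<nu>: "0 \<le> \<nu>"
  shows "norm ((mat_power W k - avg_mat) *v x) \<le> 2 * \<nu> ^ k * norm x"
proof (induction k)
  case 0
  have "norm ((mat_power W 0 - avg_mat) *v x) \<le> norm x + norm (avg_mat *v x)"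
    by (simp add: mat_power_def matrix_vector_mult_diff_rdistrib norm_triangle_ineq4)
  then show ?case using norm_avg_mat_mult_le[of x] by simp
next
  case (Suc k)
  have sym: "symmetric_mat W" and W1: "W *v 1 = 1" and \<rho>: "spectral_radius (W - avg_mat) \<le> \<nu>"
    using W by (auto simp: consensus_matrix_def symmetric_mat_def)
  have one: "(W *v y) \<bullet> 1 = y \<bullet> 1" for y
    using symmetric_mat_inner[OF sym, of y 1] W1 by simp
  have pow: "(mat_power W m *v y) \<bullet> 1 = y \<bullet> 1" for m y
    by (induction m) (simp_all add: mat_power_Suc_mult one, simp add: mat_power_def)
  let ?u = "(mat_power W k - avg_mat) *v x"
  have "(mat_power W (Suc k) - avg_mat) *v x = (W - avg_mat) *v ?u"
    by (simp add: matrix_vector_mult_diff_rdistrib matrix_vector_mult_diff_distrib mat_power_Suc_mult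
        avg_mat_mult matrix_vector_mult_scaleR W1 pow inner_one_one)
  moreover have "symmetric_mat (W - avg_mat)"
    using sym symmetric_avg_mat by (simp add: symmetric_mat_def transpose_def vec_eq_iff)
  ultimately have "norm ((mat_power W (Suc k) - avg_mat) *v x) \<le> spectral_radius (W - avg_mat) * norm ?u"
    by (simp add: symmetric_norm_le_spectral_radius)
  also have "\<dots> \<le> \<nu> * (2 * \<nu> ^ k * norm x)"
    using \<rho> Suc.IH \<nu> by (intro mult_mono) auto
  finally show ?case by (simp add: mult_ac)
qed

lemma consensus_power_row_dev:
  fixes W :: "real ^ 'v ^ 'v"
  assumes "consensus_matrix E \<nu> W" "0 \<le> \<nu>"
  shows "(\<Sum>j\<in>UNIV. \<bar>(mat_power W k - avg_mat) $ i $ j\<bar>) \<le> 2 * real CARD('v) * \<nu> ^ k"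
proof -
  have "\<bar>(mat_power W k - avg_mat) $ i $ j\<bar> \<le> 2 * \<nu> ^ k" for j
  proof -
    have "\<bar>(mat_power W k - avg_mat) $ i $ j\<bar> = \<bar>((mat_power W k - avg_mat) *v axis j 1) $ i\<bar>"
      by (simp add: matrix_vector_mult_basis column_def)
    also have "\<dots> \<le> norm ((mat_power W k - avg_mat) *v axis j 1)"
      by (rule component_le_norm_cart)
    also have "\<dots> \<le> 2 * \<nu> ^ k"
      using consensus_power_dev[OF assms, of k "axis j 1"] by simp
    finally show ?thesis .
  qed
  then have "(\<Sum>j\<in>UNIV. \<bar>(mat_power W k - avg_mat) $ i $ j\<bar>) \<le> (\<Sum>j\<in>(UNIV :: 'v set). 2 * \<nu> ^ k)"
    by (intro sum_mono)
  then show ?thesis by simp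
qed

lemma consensus_power_row_sum:
  assumes "consensus_matrix E \<nu> W" shows "(\<Sum>j\<in>UNIV. mat_power W k $ i $ j) = 1"
proof -
  have "(mat_power W k *v 1) $ i = 1"
    using assms by (simp add: mat_power_one consensus_matrix_def)
  then show ?thesis by (simp add: matrix_vector_mult_def)
qed

text \<open>Multiplying by the negative number \<open>ln \<nu>\<close> reverses the inequality, so
  the lower bound on the number of consensus steps becomes an upper bound on the power.\<close>

lemma power_le_of_ln_bound:
  fixes \<nu> \<beta> c :: real
  assumes "0 < \<nu>" "\<nu> < 1" "0 < \<beta>" "0 < c" "0 \<le> \<delta>"
    and "real \<phi> \<ge> (ln \<beta> - ln c) / ln \<nu> + \<delta>"
  shows "c * \<nu> ^ \<phi> \<le> \<beta>"
proof -
  have l: "ln \<nu> < 0" using assms by simp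
  have "(ln \<beta> - ln c) / ln \<nu> \<le> real \<phi>" using assms by linarith
  then have "real \<phi> * ln \<nu> \<le> ln \<beta> - ln c" using l by (simp add: divide_le_eq)
  then have "ln (c * \<nu> ^ \<phi>) \<le> ln \<beta>"
    using assms by (simp add: ln_mult ln_realpow)
  then show ?thesis using assms by simp
qed

section \<open>Projected consensus iterations\<close>

text \<open>Squared distances add over the components, so the two projections of the algorithm form
  one projection in the product space.\<close>

lemma closest_point_Times:
  fixes A :: "'a :: euclidean_space set" and B :: "'b :: euclidean_space set"
  assumes "convex A" "closed A" "A \<noteq> {}" "convex B" "closed B" "B \<noteq> {}"
  shows "closest_point (A \<times> B) (a, b) = (closest_point A a, closest_point B b)"
proof (rule sym, rule closest_point_unique)
  show "(closest_point A a, closest_point B b) \<in> A \<times> B"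
    using assms by (simp add: closest_point_in_set)
  show "\<forall>z\<in>A \<times> B. dist (a, b) (closest_point A a, closest_point B b) \<le> dist (a, b) z"
    using assms by (auto simp: dist_Pair_Pair intro!: real_sqrt_le_mono add_mono power_mono closest_point_le)
qed (use assms in \<open>auto intro: convex_Times closed_Times\<close>)

text \<open>Only the size of \<open>g\<close> matters here; that it consists of supergradients
  enters later. \<open>row_dev\<close> says that one mixing round shrinks the radius
  \<open>\<beta> + \<alpha> * M\<close> back to \<open>\<beta>\<close>. The initial points may be
  far apart, so the first round has its own assumption \<open>init\<close>.\<close>

locale projected_consensus =
  fixes Z :: "'a :: euclidean_space set" and V :: "real ^ 'v ^ 'v"
    and \<alpha> \<beta> M \<tau> :: real and z g :: "nat \<Rightarrow> 'v \<Rightarrow> 'a"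
  assumes Z: "convex Z" "closed Z" "Z \<noteq> {}"
    and \<alpha>: "0 < \<alpha>"
    and step: "z (Suc k) i = closest_point Z (\<Sum>j\<in>UNIV. V $ i $ j *\<^sub>R (z k j + \<alpha> *\<^sub>R g k j))"
    and norm_g: "norm (g k j) \<le> M"
    and row_sum: "(\<Sum>j\<in>UNIV. V $ i $ j) = 1"
    and row_dev: "(\<Sum>j\<in>UNIV. \<bar>(V - avg_mat) $ i $ j\<bar>) * (\<beta> + \<alpha> * M) \<le> \<beta>"
    and init: "norm (\<Sum>j\<in>UNIV. (V - avg_mat) $ i $ j *\<^sub>R (z 0 j + \<alpha> *\<^sub>R g 0 j)) \<le> \<beta>"
    and \<tau>: "\<beta> / \<alpha> \<le> \<tau>"
begin

definition n :: real where "n = real CARD('v)"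

definition mean :: "nat \<Rightarrow> 'a" where
  "mean k = (1 / n) *\<^sub>R (\<Sum>j\<in>UNIV. z k j + \<alpha> *\<^sub>R g k j)"

text \<open>The iterate that exact averaging would give; \<open>center 0\<close> is a junk value.\<close>

definition center :: "nat \<Rightarrow> 'a" where
  "center k = closest_point Z (mean (k - 1))"

text \<open>The total displacement of the nodes from the center, scaled so that
  \<open>mean_eq\<close> is exact: averaging is then a step of size \<open>\<alpha> / n\<close> from
  the center along an inexact direction. The condition on \<open>\<tau>\<close> makes the error at
  most \<open>n * \<tau>\<close>.\<close>

definition drift :: "nat \<Rightarrow> 'a" where
  "drift k = (1 / \<alpha>) *\<^sub>R (\<Sum>i\<in>UNIV. z k i - center k)"

definition direction :: "nat \<Rightarrow> 'a" where
  "direction k = (\<Sum>i\<in>UNIV. g k i) + drift k"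

lemma n_pos: "0 < n" by (simp add: n_def)

lemma center_in: "center k \<in> Z"
  by (simp add: center_def closest_point_in_set Z)

lemma row_dev_sum: "(\<Sum>j\<in>UNIV. (V - avg_mat) $ i $ j) = 0"
  by (simp add: sum_subtractf row_sum) (simp add: avg_mat_def)

lemma mixed_minus_mean:
  "(\<Sum>j\<in>UNIV. V $ i $ j *\<^sub>R (z k j + \<alpha> *\<^sub>R g k j)) - mean k
    = (\<Sum>j\<in>UNIV. (V - avg_mat) $ i $ j *\<^sub>R (z k j + \<alpha> *\<^sub>R g k j))"
  by (simp add: mean_def scaleR_diff_left sum_subtractf scaleR_sum_right n_def avg_mat_def)

text \<open>Rows of \<open>V - avg_mat\<close> sum to zero, so the center may be subtracted from
  every summand. Projections are nonexpansive, so the new iterates lie within \<open>\<beta>\<close>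
  of it; adding the step gives radius \<open>\<beta> + \<alpha> * M\<close>, which
  \<open>row_dev\<close> contracts.\<close>

lemma mixed_close: "norm ((\<Sum>j\<in>UNIV. V $ i $ j *\<^sub>R (z k j + \<alpha> *\<^sub>R g k j)) - mean k) \<le> \<beta>"
proof (induction k arbitrary: i)
  case 0
  then show ?case using init[of i] by (simp add: mixed_minus_mean)
next
  case (Suc k)
  let ?c = "center (Suc k)" and ?B = "V - avg_mat"
  have z: "norm (z (Suc k) j - ?c) \<le> \<beta>" for j
  proof -
    have "norm (z (Suc k) j - ?c) \<le> norm ((\<Sum>l\<in>UNIV. V $ j $ l *\<^sub>R (z k l + \<alpha> *\<^sub>R g k l)) - mean k)"
      using closest_point_lipschitz[OF Z] by (simp add: step center_def dist_norm)
    then show ?thesis using Suc.IH[of j] by linarith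
  qed
  have s: "norm (z (Suc k) j + \<alpha> *\<^sub>R g (Suc k) j - ?c) \<le> \<beta> + \<alpha> * M" for j
  proof -
    have "norm (z (Suc k) j + \<alpha> *\<^sub>R g (Suc k) j - ?c) \<le> norm (z (Suc k) j - ?c) + norm (\<alpha> *\<^sub>R g (Suc k) j)"
      by (metis add_diff_eq diff_add_eq norm_triangle_ineq)
    also have "\<dots> \<le> \<beta> + \<alpha> * M"
      using z[of j] norm_g[of "Suc k" j] \<alpha> by (intro add_mono) auto
    finally show ?thesis .
  qed
  have "(\<Sum>j\<in>UNIV. ?B $ i $ j *\<^sub>R (z (Suc k) j + \<alpha> *\<^sub>R g (Suc k) j))
      = (\<Sum>j\<in>UNIV. ?B $ i $ j *\<^sub>R (z (Suc k) j + \<alpha> *\<^sub>R g (Suc k) j - ?c))"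
  proof -
    have "(\<Sum>j\<in>UNIV. ?B $ i $ j *\<^sub>R ?c) = 0"
      unfolding scaleR_left.sum[symmetric] row_dev_sum by simp
    then show ?thesis unfolding scaleR_diff_right sum_subtractf by simp
  qed
  moreover have "norm \<dots> \<le> (\<Sum>j\<in>UNIV. \<bar>?B $ i $ j\<bar> * (\<beta> + \<alpha> * M))"
    unfolding norm_scaleR[symmetric]
    by (rule sum_norm_le) (simp add: mult_left_mono s del: vector_minus_component)
  ultimately show ?case
    using row_dev[of i] by (simp add: mixed_minus_mean sum_distrib_right del: vector_minus_component)
qed

lemma close_to_center:
  assumes "1 \<le> k" shows "norm (z k i - center k) \<le> \<beta>"
proof -
  obtain m where k: "k = Suc m" using assms by (metis Suc_le_D One_nat_def)
  have "norm (z k i - center k) \<le> norm ((\<Sum>l\<in>UNIV. V $ i $ l *\<^sub>R (z m l + \<alpha> *\<^sub>R g m l)) - mean m)"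
    using closest_point_lipschitz[OF Z] by (simp add: step center_def dist_norm k)
  then show ?thesis using mixed_close[of i m] by linarith
qed

lemma norm_drift:
  assumes "1 \<le> k" shows "norm (drift k) \<le> n * \<tau>"
proof -
  have "norm (\<Sum>i\<in>UNIV. z k i - center k) \<le> (\<Sum>i\<in>(UNIV :: 'v set). \<beta>)"
    by (rule sum_norm_le) (rule close_to_center[OF assms])
  then have "norm (drift k) \<le> (1 / \<alpha>) * (n * \<beta>)"
    unfolding drift_def norm_scaleR using \<alpha> by (intro mult_mono) (auto simp: n_def)
  also have "\<dots> \<le> n * \<tau>" using mult_left_mono[OF \<tau>, of n] n_pos by simp
  finally show ?thesis .
qed

lemma norm_direction:
  assumes "1 \<le> k" shows "norm (direction k) \<le> n * (M + \<tau>)"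
proof -
  have "norm (\<Sum>i\<in>UNIV. g k i) \<le> (\<Sum>i\<in>(UNIV :: 'v set). M)"
    by (rule sum_norm_le) (rule norm_g)
  then show ?thesis
    using norm_drift[OF assms] norm_triangle_ineq[of "\<Sum>i\<in>UNIV. g k i" "drift k"]
    unfolding direction_def by (simp add: n_def algebra_simps)
qed

lemma mean_eq: "mean k = center k + (\<alpha> / n) *\<^sub>R direction k"
proof -
  have "center k = (1 / n) *\<^sub>R (\<Sum>i\<in>(UNIV :: 'v set). center k)"
    by (simp add: n_def sum_constant_scaleR)
  then show ?thesis
    using \<alpha> unfolding mean_def direction_def drift_def
    by (simp add: sum.distrib sum_subtractf scaleR_add_right scaleR_diff_right scaleR_sum_right)
qed

text \<open>The basic projected subgradient inequality: \<open>w\<close> is its own projection, so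
  projecting the mean does not increase its distance to \<open>w\<close>, and the squared distance
  before projection is expanded.\<close>

lemma center_step:
  assumes k: "1 \<le> k" and w: "w \<in> Z"
  shows "direction k \<bullet> (w - center k)
    \<le> n / (2 * \<alpha>) * ((norm (center k - w))\<^sup>2 - (norm (center (Suc k) - w))\<^sup>2) + \<alpha> * n * (M + \<tau>)\<^sup>2 / 2"
proof -
  have "norm (center (Suc k) - w) \<le> norm (mean k - w)"
    using closest_point_lipschitz[OF Z, of "mean k" w] closest_point_self[OF w]
    by (simp add: center_def dist_norm)
  then have "(norm (center (Suc k) - w))\<^sup>2 \<le> (norm (mean k - w))\<^sup>2"
    by (rule power_mono) simp
  also have "mean k - w = (center k - w) + (\<alpha> / n) *\<^sub>R direction k" by (simp add: mean_eq)
  also have "(norm \<dots>)\<^sup>2 = (norm (center k - w))\<^sup>2 - 2 * (\<alpha> / n) * (direction k \<bullet> (w - center k))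
      + (\<alpha> / n)\<^sup>2 * (norm (direction k))\<^sup>2"
    unfolding power2_norm_eq_inner
    by (simp add: inner_diff_left inner_diff_right inner_add_left inner_add_right inner_commute
        power2_eq_square algebra_simps)
  also have "\<dots> \<le> (norm (center k - w))\<^sup>2 - 2 * (\<alpha> / n) * (direction k \<bullet> (w - center k))
      + (\<alpha> / n)\<^sup>2 * (n * (M + \<tau>))\<^sup>2"
    using norm_direction[OF k] by (intro add_left_mono mult_left_mono power_mono) auto
  finally have "2 * (\<alpha> / n) * (direction k \<bullet> (w - center k))
      \<le> (norm (center k - w))\<^sup>2 - (norm (center (Suc k) - w))\<^sup>2 + (\<alpha> / n)\<^sup>2 * (n * (M + \<tau>))\<^sup>2"
    by linarith
  then have "n / (2 * \<alpha>) * (2 * (\<alpha> / n) * (direction k \<bullet> (w - center k)))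
      \<le> n / (2 * \<alpha>) * ((norm (center k - w))\<^sup>2 - (norm (center (Suc k) - w))\<^sup>2 + (\<alpha> / n)\<^sup>2 * (n * (M + \<tau>))\<^sup>2)"
    using n_pos \<alpha> by (intro mult_left_mono) auto
  moreover have "n / (2 * \<alpha>) * ((\<alpha> / n)\<^sup>2 * (n * (M + \<tau>))\<^sup>2) = \<alpha> * n * (M + \<tau>)\<^sup>2 / 2"
    using n_pos \<alpha> by (simp add: power2_eq_square field_simps)
  ultimately show ?thesis
    using n_pos \<alpha> by (simp add: distrib_left)
qed

lemma average_direction_le:
  assumes k: "1 \<le> k" and w: "w \<in> Z"
  shows "(\<Sum>t=1..k. direction t \<bullet> (w - center t)) / real k
    \<le> (norm (center 1 - w))\<^sup>2 / (2 * real k * \<alpha> / n) + \<alpha> * n * (M + \<tau>)\<^sup>2 / 2"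
proof -
  let ?D = "\<lambda>t. (norm (center t - w))\<^sup>2" and ?C = "\<alpha> * n * (M + \<tau>)\<^sup>2 / 2"
  have "(\<Sum>t=1..k. direction t \<bullet> (w - center t)) \<le> (\<Sum>t=1..k. n / (2 * \<alpha>) * (?D t - ?D (Suc t)) + ?C)"
    using center_step[OF _ w] by (intro sum_mono) auto
  also have "\<dots> = n / (2 * \<alpha>) * (\<Sum>t=1..k. ?D t - ?D (Suc t)) + real k * ?C"
    by (simp add: sum.distrib sum_distrib_left)
  also have "(\<Sum>t=1..k. ?D t - ?D (Suc t)) = ?D 1 - ?D (Suc k)"
    using k by (induction k rule: dec_induct) auto
  also have "n / (2 * \<alpha>) * (?D 1 - ?D (Suc k)) \<le> n / (2 * \<alpha>) * ?D 1"
    using n_pos \<alpha> by (intro mult_left_mono) auto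
  finally have "(\<Sum>t=1..k. direction t \<bullet> (w - center t)) / real k \<le> (n / (2 * \<alpha>) * ?D 1 + real k * ?C) / real k"
    by (intro divide_right_mono) auto
  also have "\<dots> = ?D 1 / (2 * real k * \<alpha> / n) + ?C"
    using k n_pos \<alpha> by (simp add: field_simps)
  finally show ?thesis .
qed

end

section \<open>Lagrangian duality\<close>

definition dual_grad :: "('v :: finite, 'd :: finite) coupled_problem \<Rightarrow> 'v \<Rightarrow> real \<Rightarrow> real \<times> (real ^ 'd ^ 'd)" where
  "dual_grad P i t = (constr P i t, - local_mat P i t)"

lemma local_lagrangian_eq:
  assumes "symmetric_mat H"
  shows "local_lagrangian P i t m H = cost P i t + dual_grad P i t \<bullet> (m, H)"
  by (simp add: local_lagrangian_def dual_grad_def trace_mult_symmetric[OF assms] mult.commute)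

lemma sum_dual_grad:
  fixes P :: "('v :: finite, 'd :: finite) coupled_problem"
  shows "(\<Sum>i\<in>UNIV. dual_grad P i (x $ i)) = (total_constr P x, - lmi P x)"
proof -
  have "(\<Sum>i\<in>(UNIV :: 'v set). (1 / real CARD('v)) *\<^sub>R mat0 P) = mat0 P"
    by (simp only: sum_constant_scaleR) simp
  then have "(\<Sum>i\<in>UNIV. local_mat P i (x $ i)) = lmi P x"
    unfolding local_mat_def lmi_def sum.distrib by simp
  then show ?thesis
    by (simp add: dual_grad_def total_constr_def prod_eq_iff fst_sum snd_sum sum_negf)
qed

lemma transpose_inner_transpose: "transpose A \<bullet> transpose B = A \<bullet> B" for A B :: "real ^ 'd ^ 'd"
  unfolding inner_vec_def transpose_def inner_real_def by (simp, rule sum.swap)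

text \<open>Reads off the sign of one coefficient of a separating functional by letting the
  corresponding slack grow.\<close>

lemma nonneg_of_nonneg_ray:
  fixes a b :: real
  assumes "\<And>t. 0 < t \<Longrightarrow> 0 \<le> a + t * b" shows "0 \<le> b"
proof (rule ccontr)
  assume b: "\<not> 0 \<le> b"
  then have "0 < (\<bar>a\<bar> + 1) / (- b)" by (intro divide_pos_pos) auto
  from assms[OF this] have "0 \<le> a - (\<bar>a\<bar> + 1)" using b by simp
  then show False by linarith
qed

text \<open>The cost slack in the separated set will be strict, so slack zero is reached only as a
  limit.\<close>

lemma nonneg_of_nonneg_ray_start:
  fixes a b :: real
  assumes "\<And>t. 0 < t \<Longrightarrow> 0 \<le> a + t * b" shows "0 \<le> a"
proof (rule tendsto_lowerbound)
  show "((\<lambda>t. a + t * b) \<longlongrightarrow> a) (at_right 0)" by (auto intro!: tendsto_eq_intros)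
  show "\<forall>\<^sub>F t in at_right 0. 0 \<le> a + t * b"
    using assms by (auto simp: eventually_at_right_less intro: eventually_mono[OF eventually_at_right_less])
qed simp

section \<open>Attained local duals and weak duality\<close>

locale slater_problem =
  fixes P :: "('v :: finite, 'd :: finite) coupled_problem" and xbar :: "real ^ 'v"
  assumes convex: "convex_problem P" and slater: "slater_vector P xbar"
begin

lemma convex_cost: "convex_on UNIV (cost P i)"
  and convex_constr: "convex_on UNIV (constr P i)"
  and convex_local: "convex (local_set P i)"
  and compact_local: "compact (local_set P i)"
  and symmetric_mats: "symmetric_mat (mats P i)"
  and symmetric_mat0: "symmetric_mat (mat0 P)"
  using convex by (auto simp: convex_problem_def)

lemma xbar_in: "xbar \<in> product_set P"
  and xbar_constr: "total_constr P xbar < 0"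
  and xbar_lmi: "posdef (lmi P xbar)"
  using slater by (auto simp: slater_vector_def)

lemma local_nonempty: "local_set P i \<noteq> {}"
  using xbar_in by (auto simp: product_set_def)

lemma continuous_cost: "continuous_on S (cost P i)"
  using convex_on_continuous[OF open_UNIV convex_cost] continuous_on_subset by blast

lemma continuous_constr: "continuous_on S (constr P i)"
  using convex_on_continuous[OF open_UNIV convex_constr] continuous_on_subset by blast

lemma continuous_local_lagrangian: "continuous_on S (\<lambda>t. local_lagrangian P i t m H)"
proof -
  have "continuous_on S (\<lambda>t. trace (local_mat P i t ** H))"
    unfolding trace_def matrix_matrix_mult_def local_mat_def by (auto intro!: continuous_intros)
  then show ?thesis
    unfolding local_lagrangian_def by (intro continuous_intros continuous_cost continuous_constr)
qed

lemma local_dual_attained: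
  obtains t where "t \<in> local_set P i" "local_dual P i m H = local_lagrangian P i t m H"
    "\<And>s. s \<in> local_set P i \<Longrightarrow> local_dual P i m H \<le> local_lagrangian P i s m H"
proof -
  obtain t where t: "t \<in> local_set P i"
    "\<And>s. s \<in> local_set P i \<Longrightarrow> local_lagrangian P i t m H \<le> local_lagrangian P i s m H"
    using continuous_attains_inf[OF compact_local local_nonempty continuous_local_lagrangian[of _ i m H], of i]
    by blast
  then have "local_dual P i m H = local_lagrangian P i t m H"
    unfolding local_dual_def by (intro cInf_eq_minimum) auto
  then show ?thesis using t that by metis
qed

lemma local_dual_le: "t \<in> local_set P i \<Longrightarrow> local_dual P i m H \<le> local_lagrangian P i t m H"
  by (rule local_dual_attained[of i m H]) blast

lemma dual_le_lagrangian:
  assumes "x \<in> product_set P" "symmetric_mat H"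
  shows "dual_fun P m H \<le> total_cost P x + (total_constr P x, - lmi P x) \<bullet> (m, H)"
proof -
  have "dual_fun P m H \<le> (\<Sum>i\<in>UNIV. local_lagrangian P i (x $ i) m H)"
    unfolding dual_fun_def using assms by (intro sum_mono local_dual_le) (simp add: product_set_def)
  also have "\<dots> = total_cost P x + (\<Sum>i\<in>UNIV. dual_grad P i (x $ i)) \<bullet> (m, H)"
    by (simp add: local_lagrangian_eq[OF assms(2)] sum.distrib total_cost_def inner_sum_left)
  finally show ?thesis by (simp add: sum_dual_grad)
qed

lemma weak_duality:
  assumes "x \<in> feasible_set P" "0 \<le> m" "psd H"
  shows "dual_fun P m H \<le> total_cost P x"
proof -
  have x: "x \<in> product_set P" "total_constr P x \<le> 0" "psd (lmi P x)"
    using assms(1) by (auto simp: feasible_set_def)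
  have "0 \<le> lmi P x \<bullet> H" using psd_inner_nonneg[OF x(3), of H] assms(3) by (simp add: psd_def)
  moreover have "total_constr P x * m \<le> 0" using x(2) assms(2) by (simp add: mult_nonpos_nonneg)
  ultimately show ?thesis
    using dual_le_lagrangian[OF x(1), of H m] assms(3) by (simp add: psd_def)
qed

lemma xbar_feasible: "xbar \<in> feasible_set P"
  using xbar_in xbar_constr psd_posdef[OF xbar_lmi] by (simp add: feasible_set_def)

lemma dual_le_opt: "0 \<le> m \<Longrightarrow> psd H \<Longrightarrow> dual_fun P m H \<le> opt_value P"
  unfolding opt_value_def using xbar_feasible weak_duality by (intro cINF_greatest) auto

text \<open>A real infimum is a lower bound only when one exists; weak duality at the zero
  multiplier supplies it.\<close>

lemma opt_le_cost: "x \<in> feasible_set P \<Longrightarrow> opt_value P \<le> total_cost P x"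
  unfolding opt_value_def
  by (intro cINF_lower bdd_belowI2[where m = "dual_fun P 0 0"] weak_duality) (auto simp: psd_0)

lemma norm_dual_grad:
  assumes t: "t \<in> local_set P i"
  shows "norm (dual_grad P i t) \<le> bound_L P + bound_Q P"
proof -
  have "compact ((\<lambda>t. \<bar>constr P i t\<bar>) ` local_set P i)"
    by (intro compact_continuous_image continuous_intros continuous_constr compact_local)
  then have "\<bar>constr P i t\<bar> \<le> (SUP t\<in>local_set P i. \<bar>constr P i t\<bar>)"
    using t by (intro cSUP_upper bounded_imp_bdd_above compact_imp_bounded)
  also have "\<dots> \<le> bound_L P" unfolding bound_L_def by (intro Max_ge) auto
  finally have L: "\<bar>constr P i t\<bar> \<le> bound_L P" .
  have "compact ((\<lambda>t. norm (- local_mat P i t)) ` local_set P i)"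
    unfolding local_mat_def by (intro compact_continuous_image continuous_intros compact_local)
  then have "norm (- local_mat P i t) \<le> (SUP t\<in>local_set P i. norm (- local_mat P i t))"
    using t by (intro cSUP_upper bounded_imp_bdd_above compact_imp_bounded)
  also have "\<dots> \<le> bound_Q P" unfolding bound_Q_def by (intro Max_ge) auto
  finally have Q: "norm (- local_mat P i t) \<le> bound_Q P" .
  have "norm (dual_grad P i t) \<le> norm (constr P i t) + norm (- local_mat P i t)"
    unfolding dual_grad_def by (rule norm_Pair_le)
  then show ?thesis using L Q by simp
qed

section \<open>Strong duality and the size of Slater multipliers\<close>

lemma convex_product: "convex (product_set P)"
  unfolding product_set_def convex_def
  using convex_local by (auto simp: convex_def)

lemma total_convex:
  assumes "0 \<le> u" "0 \<le> v" "u + v = 1"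
  shows "total_cost P (u *\<^sub>R x + v *\<^sub>R y) \<le> u * total_cost P x + v * total_cost P y"
    and "total_constr P (u *\<^sub>R x + v *\<^sub>R y) \<le> u * total_constr P x + v * total_constr P y"
proof -
  have "convex_on UNIV (total_cost P)" "convex_on UNIV (total_constr P)"
    unfolding convex_on_def total_cost_def total_constr_def
    using convex_cost convex_constr
    by (auto simp: convex_on_def sum_distrib_left simp flip: sum.distrib intro!: sum_mono)
  then show "total_cost P (u *\<^sub>R x + v *\<^sub>R y) \<le> u * total_cost P x + v * total_cost P y"
    and "total_constr P (u *\<^sub>R x + v *\<^sub>R y) \<le> u * total_constr P x + v * total_constr P y"
    using assms by (auto simp: convex_on_def)
qed

lemma lmi_affine:
  assumes "u + v = 1"
  shows "lmi P (u *\<^sub>R x + v *\<^sub>R y) = u *\<^sub>R lmi P x + v *\<^sub>R lmi P y"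
proof -
  have "mat0 P = u *\<^sub>R mat0 P + v *\<^sub>R mat0 P"
    using assms by (simp flip: scaleR_add_left)
  then show ?thesis
    by (simp add: lmi_def scaleR_add_left scaleR_add_right sum.distrib scaleR_sum_right)
qed

lemma symmetric_lmi: "symmetric_mat (lmi P x)"
  using symmetric_mat_component[OF symmetric_mat0] symmetric_mat_component[OF symmetric_mats]
  by (simp add: symmetric_mat_def lmi_def transpose_def vec_eq_iff)

lemma slater_gap_pos: "0 < slater_gap P xbar"
  using xbar_constr posdef_lambda_min_pos[OF xbar_lmi] by (simp add: slater_gap_def)

text \<open>At the Slater vector the penalty decreases at least linearly in the size of the
  multiplier. This both bounds optimal multipliers and excludes a separating functional that ignores
  the cost.\<close>

lemma slater_gap_mult_le:
  assumes "0 \<le> m" "psd H"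
  shows "slater_gap P xbar * (m + norm H) \<le> - ((total_constr P xbar, - lmi P xbar) \<bullet> (m, H))"
proof -
  have "slater_gap P xbar * m \<le> - total_constr P xbar * m"
    using assms by (intro mult_right_mono) (auto simp: slater_gap_def)
  moreover have "slater_gap P xbar * norm H \<le> lambda_min (lmi P xbar) * norm H"
    by (intro mult_right_mono) (auto simp: slater_gap_def)
  moreover have "lambda_min (lmi P xbar) * norm H \<le> H \<bullet> lmi P xbar"
    using lambda_min_norm_le_inner[OF symmetric_lmi _ assms(2)] posdef_lambda_min_pos[OF xbar_lmi]
    by simp
  ultimately show ?thesis by (simp add: distrib_left inner_commute mult.commute)
qed

text \<open>The matrix component of \<open>epigraph\<close> deliberately ranges over nonsymmetric matrices as well;
  this forces the multiplier of the separating hyperplane to be symmetric.\<close>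

definition epigraph :: "(real \<times> real \<times> (real ^ 'd ^ 'd)) set" where
  "epigraph = {(p, s, S). \<exists>x\<in>product_set P. total_cost P x - opt_value P < p \<and> total_constr P x \<le> s \<and>
     (\<forall>v. 0 \<le> v \<bullet> ((S + lmi P x) *v v))}"

lemma convex_epigraph: "convex epigraph"
  unfolding convex_def
proof (intro ballI allI impI)
  fix a b :: "real \<times> real \<times> (real ^ 'd ^ 'd)" and u v :: real
  assume a: "a \<in> epigraph" and b: "b \<in> epigraph" and uv: "0 \<le> u" "0 \<le> v" "u + v = 1"
  obtain p s S where a': "a = (p, s, S)" by (cases a)
  obtain p' s' S' where b': "b = (p', s', S')" by (cases b)
  obtain x where x: "x \<in> product_set P" "total_cost P x - opt_value P < p" "total_constr P x \<le> s"
    "\<And>w. 0 \<le> w \<bullet> ((S + lmi P x) *v w)" using a by (auto simp: epigraph_def a')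
  obtain y where y: "y \<in> product_set P" "total_cost P y - opt_value P < p'" "total_constr P y \<le> s'"
    "\<And>w. 0 \<le> w \<bullet> ((S' + lmi P y) *v w)" using b by (auto simp: epigraph_def b')
  let ?z = "u *\<^sub>R x + v *\<^sub>R y"
  have "?z \<in> product_set P" using convexD[OF convex_product x(1) y(1) uv] .
  moreover have "total_cost P ?z - opt_value P < u * p + v * p'"
  proof -
    have "u * (total_cost P x - opt_value P) + v * (total_cost P y - opt_value P) < u * p + v * p'"
    proof (cases "u = 0")
      case True
      then show ?thesis using y(2) uv by simp
    next
      case False
      then show ?thesis using x(2) y(2) uv by (intro add_less_le_mono mult_left_mono) auto
    qed
    moreover have "u * (total_cost P x - opt_value P) + v * (total_cost P y - opt_value P)
        = u * total_cost P x + v * total_cost P y - (u + v) * opt_value P"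
      by (simp add: algebra_simps)
    ultimately show ?thesis using total_convex(1)[OF uv, of x y] uv(3) by simp
  qed
  moreover have "total_constr P ?z \<le> u * s + v * s'"
  proof -
    have "u * total_constr P x \<le> u * s" "v * total_constr P y \<le> v * s'"
      using x(3) y(3) uv by (auto intro: mult_left_mono)
    then show ?thesis using total_convex(2)[OF uv, of x y] by linarith
  qed
  moreover have "0 \<le> w \<bullet> ((u *\<^sub>R S + v *\<^sub>R S' + lmi P ?z) *v w)" for w
  proof -
    have "u *\<^sub>R S + v *\<^sub>R S' + lmi P ?z = u *\<^sub>R (S + lmi P x) + v *\<^sub>R (S' + lmi P y)"
      by (simp add: lmi_affine[OF uv(3)] scaleR_add_right)
    then have "w \<bullet> ((u *\<^sub>R S + v *\<^sub>R S' + lmi P ?z) *v w)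
        = u * (w \<bullet> ((S + lmi P x) *v w)) + v * (w \<bullet> ((S' + lmi P y) *v w))"
      by (simp only: matrix_vector_mult_add_rdistrib[of "u *\<^sub>R _"] scaleR_matrix_vector_assoc[symmetric]
          inner_add_right inner_scaleR_right)
    then show ?thesis using x(4)[of w] y(4)[of w] uv by simp
  qed
  ultimately show "u *\<^sub>R a + v *\<^sub>R b \<in> epigraph"
    unfolding a' b' epigraph_def by auto
qed

lemma zero_notin_epigraph: "0 \<notin> epigraph"
proof
  assume "0 \<in> epigraph"
  then obtain x where x: "x \<in> product_set P" "total_cost P x < opt_value P" "total_constr P x \<le> 0"
    "\<And>v. 0 \<le> v \<bullet> (lmi P x *v v)" by (auto simp: epigraph_def zero_prod_def)
  then have "x \<in> feasible_set P" by (simp add: feasible_set_def psd_def symmetric_lmi)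
  then show False using opt_le_cost x(2) by fastforce
qed

text \<open>Strong duality: separate the origin from \<open>epigraph\<close>, use the free slacks to
  determine the signs of the coefficients, and divide by the cost coefficient
  \<open>l\<close>.\<close>

lemma dual_multiplier_exists:
  obtains m H where "0 \<le> m" "psd H"
    "\<And>x. x \<in> product_set P \<Longrightarrow> opt_value P \<le> total_cost P x + (total_constr P x, - lmi P x) \<bullet> (m, H)"
proof -
  obtain a where "a \<noteq> 0" and a: "\<And>y. y \<in> epigraph \<Longrightarrow> 0 \<le> a \<bullet> y"
    using separating_hyperplane_set_0[OF convex_epigraph zero_notin_epigraph] by blast
  obtain l m H where lmH: "a = (l, m, H)" by (cases a)
  have sep: "0 \<le> l * (total_cost P x - opt_value P + t) + m * (total_constr P x + s) + H \<bullet> (S - lmi P x)"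
    if "x \<in> product_set P" "0 < t" "0 \<le> s" "\<And>v. 0 \<le> v \<bullet> (S *v v)" for x t s S
  proof -
    have "(total_cost P x - opt_value P + t, total_constr P x + s, S - lmi P x) \<in> epigraph"
      unfolding epigraph_def using that by (auto intro!: bexI[of _ x])
    then show ?thesis using a by (fastforce simp: lmH)
  qed
  have 1: "0 \<le> l"
    by (rule nonneg_of_nonneg_ray[of "l * (total_cost P xbar - opt_value P) + m * total_constr P xbar - H \<bullet> lmi P xbar"])
      (use sep[OF xbar_in, of _ 0 0] in \<open>simp add: algebra_simps\<close>)
  have m: "0 \<le> m"
    by (rule nonneg_of_nonneg_ray[of "l * (total_cost P xbar - opt_value P + 1) + m * total_constr P xbar - H \<bullet> lmi P xbar"])
      (use sep[OF xbar_in, of 1 _ 0] in \<open>simp add: algebra_simps\<close>)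
  have HT: "0 \<le> H \<bullet> T" if T: "\<And>v. 0 \<le> v \<bullet> (T *v v)" for T
  proof (rule nonneg_of_nonneg_ray[of "l * (total_cost P xbar - opt_value P + 1) + m * total_constr P xbar - H \<bullet> lmi P xbar"])
    fix t :: real assume "0 < t"
    then have "0 \<le> v \<bullet> ((t *\<^sub>R T) *v v)" for v
      using T[of v] by (simp add: scaleR_matrix_vector_assoc[symmetric])
    then show "0 \<le> l * (total_cost P xbar - opt_value P + 1) + m * total_constr P xbar - H \<bullet> lmi P xbar + t * (H \<bullet> T)"
      using sep[OF xbar_in, of 1 0 "t *\<^sub>R T"] by (simp add: inner_diff_right algebra_simps)
  qed
  \<comment> \<open>An antisymmetric matrix has zero quadratic form and is therefore an admissible
    slack. Its pairing with \<open>H\<close> is minus half the squared norm of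
    \<open>transpose H - H\<close>, so nonnegativity forces symmetry.\<close>
  have "v \<bullet> ((transpose H - H) *v v) = 0" for v
  proof -
    have "v \<bullet> (transpose H *v v) = v \<bullet> (H *v v)"
      by (metis dot_lmul_matrix inner_commute transpose_matrix_vector)
    then show ?thesis by (simp add: matrix_vector_mult_diff_rdistrib inner_diff_right del: transpose_matrix_vector)
  qed
  then have "0 \<le> H \<bullet> (transpose H - H)" by (intro HT) simp
  then have "(norm (transpose H - H))\<^sup>2 \<le> 0"
    unfolding power2_norm_eq_inner
    by (simp add: inner_diff_left inner_diff_right transpose_inner_transpose inner_commute)
  then have "symmetric_mat H" by (simp add: symmetric_mat_def)
  moreover have "0 \<le> v \<bullet> (H *v v)" for v
    using HT[of "outer v"] by (simp add: inner_commute[of H] inner_outer outer_quadratic)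
  ultimately have H: "psd H" by (simp add: psd_def)
  have lag: "0 \<le> l * (total_cost P x - opt_value P) + (total_constr P x, - lmi P x) \<bullet> (m, H)"
    if x: "x \<in> product_set P" for x
    by (rule nonneg_of_nonneg_ray_start[of _ l])
      (use sep[OF x, of _ 0 0] in \<open>simp add: algebra_simps inner_commute\<close>)
  have "l \<noteq> 0"
  proof
    assume l: "l = 0"
    have "slater_gap P xbar * (m + norm H) \<le> 0"
      using slater_gap_mult_le[OF m H] lag[OF xbar_in] by (simp add: l)
    then have "m + norm H \<le> 0" using slater_gap_pos by (simp add: mult_le_0_iff)
    then have "m = 0" "norm H = 0" using m norm_ge_zero[of H] by linarith+
    then show False using \<open>a \<noteq> 0\<close> l by (simp add: lmH zero_prod_def)
  qed
  with 1 have l: "0 < l" by simp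
  show thesis
  proof (rule that[of "m / l" "(1 / l) *\<^sub>R H"])
    show "0 \<le> m / l" "psd ((1 / l) *\<^sub>R H)" using l m H by (auto intro: psd_scaleR)
    fix x assume "x \<in> product_set P"
    then show "opt_value P \<le> total_cost P x + (total_constr P x, - lmi P x) \<bullet> (m / l, (1 / l) *\<^sub>R H)"
      using lag[of x] l by (simp add: field_simps)
  qed
qed

lemma multiplier_le_bound:
  assumes "0 \<le> m" "psd H" "0 \<le> mt" "psd Ht"
    and "opt_value P \<le> total_cost P xbar + (total_constr P xbar, - lmi P xbar) \<bullet> (m, H)"
  shows "m + norm H \<le> multiplier_bound P xbar mt Ht"
proof -
  have "slater_gap P xbar * (m + norm H) \<le> total_cost P xbar - dual_fun P mt Ht"
    using slater_gap_mult_le[OF assms(1,2)] assms(5) dual_le_opt[OF assms(3,4)] by linarith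
  then show ?thesis
    unfolding multiplier_bound_def using slater_gap_pos by (simp add: pos_le_divide_eq mult.commute)
qed

text \<open>The minimiser at the target point (m, H) competes in the minimum at \<open>z i\<close>,
  and the Lagrangian is affine in the dual point with slope at most L + Q.\<close>

lemma sum_local_dual_le:
  assumes "\<And>i. psd (snd (z i))" "psd H" "\<And>i. norm (z i - (m, H)) \<le> b"
  shows "(\<Sum>i\<in>UNIV. local_dual P i (fst (z i)) (snd (z i)))
    \<le> dual_fun P m H + real CARD('v) * ((bound_L P + bound_Q P) * b)"
proof -
  have "local_dual P i (fst (z i)) (snd (z i)) \<le> local_dual P i m H + (bound_L P + bound_Q P) * b" for i
  proof -
    obtain t where t: "t \<in> local_set P i" "local_dual P i m H = local_lagrangian P i t m H"
      using local_dual_attained[of i m H] by metis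
    have "dual_grad P i t \<bullet> (z i - (m, H)) \<le> norm (dual_grad P i t) * norm (z i - (m, H))"
      by (rule norm_cauchy_schwarz)
    also have "\<dots> \<le> (bound_L P + bound_Q P) * b"
      using norm_dual_grad[OF t(1)] assms(3)[of i] by (intro mult_mono) (auto intro: order_trans[OF norm_ge_zero])
    finally have "dual_grad P i t \<bullet> z i \<le> dual_grad P i t \<bullet> (m, H) + (bound_L P + bound_Q P) * b"
      by (simp add: inner_diff_right)
    moreover have "local_lagrangian P i t (fst (z i)) (snd (z i)) = cost P i t + dual_grad P i t \<bullet> z i"
      using assms(1)[of i] by (simp add: local_lagrangian_eq psd_def)
    moreover have "local_lagrangian P i t m H = cost P i t + dual_grad P i t \<bullet> (m, H)"
      using assms(2) by (simp add: local_lagrangian_eq psd_def)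
    ultimately show ?thesis using local_dual_le[OF t(1), of "fst (z i)" "snd (z i)"] t(2) by linarith
  qed
  then have "(\<Sum>i\<in>UNIV. local_dual P i (fst (z i)) (snd (z i)))
      \<le> (\<Sum>i\<in>UNIV. local_dual P i m H + (bound_L P + bound_Q P) * b)"
    by (intro sum_mono)
  then show ?thesis by (simp add: dual_fun_def sum.distrib)
qed

section \<open>Averages of the local minimisers\<close>

lemma recovered_primal_in:
  assumes "\<And>t i. xt t i \<in> local_set P i" "1 \<le> k"
  shows "recovered_primal xt k \<in> product_set P"
proof -
  have "(\<Sum>t=1..k. (1 / real k) *\<^sub>R xt t i) \<in> local_set P i" for i
    using assms by (intro convex_sum[OF _ convex_local]) auto
  then show ?thesis
    by (simp add: product_set_def recovered_primal_def sum_divide_distrib)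
qed

lemma convex_average:
  fixes f :: "real \<Rightarrow> real"
  assumes "convex_on UNIV f" "1 \<le> k"
  shows "f ((1 / real k) * (\<Sum>t=1..k. y t)) \<le> (\<Sum>t=1..k. f (y t)) / real k"
  using convex_on_sum[of "{1..k}" UNIV f "\<lambda>_. 1 / real k" y] assms
  by (simp add: sum_divide_distrib)

lemma recovered_cost_le:
  assumes "1 \<le> k"
  shows "total_cost P (recovered_primal xt k) \<le> (\<Sum>t=1..k. \<Sum>i\<in>UNIV. cost P i (xt t i)) / real k"
proof -
  have "total_cost P (recovered_primal xt k) \<le> (\<Sum>i\<in>UNIV. (\<Sum>t=1..k. cost P i (xt t i)) / real k)"
    unfolding total_cost_def recovered_primal_def
    using convex_average[OF convex_cost assms] by (auto intro: sum_mono)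
  also have "\<dots> = (\<Sum>t=1..k. \<Sum>i\<in>UNIV. cost P i (xt t i)) / real k"
    unfolding sum_divide_distrib[symmetric] by (subst sum.swap) (rule refl)
  finally show ?thesis .
qed

text \<open>A nonnegative \<open>m\<close> preserves the convexity inequality of the scalar
  constraint; the matrix part is affine, so averaging it is an equality for any
  \<open>H\<close>.\<close>

lemma recovered_constraints_le:
  assumes k: "1 \<le> k" and m: "0 \<le> m"
  shows "(total_constr P (recovered_primal xt k), - lmi P (recovered_primal xt k)) \<bullet> (m, H)
    \<le> (\<Sum>t=1..k. (\<Sum>i\<in>UNIV. dual_grad P i (xt t i)) \<bullet> (m, H)) / real k"
proof -
  let ?x = "recovered_primal xt k"
  have "dual_grad P i (?x $ i) \<bullet> (m, H) \<le> (\<Sum>t=1..k. dual_grad P i (xt t i) \<bullet> (m, H)) / real k" for i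
  proof -
    have "constr P i (?x $ i) * m \<le> (\<Sum>t=1..k. constr P i (xt t i)) / real k * m"
      using convex_average[OF convex_constr k, of i "\<lambda>t. xt t i"] m
      by (intro mult_right_mono) (auto simp: recovered_primal_def)
    moreover have "local_mat P i (?x $ i) \<bullet> H = (\<Sum>t=1..k. local_mat P i (xt t i) \<bullet> H) / real k"
      using k by (simp add: recovered_primal_def local_mat_def inner_add_left sum.distrib
          sum_distrib_right add_divide_distrib)
    ultimately show ?thesis
      by (simp add: dual_grad_def sum_subtractf diff_divide_distrib sum_distrib_right)
  qed
  then have "(\<Sum>i\<in>UNIV. dual_grad P i (?x $ i) \<bullet> (m, H))
      \<le> (\<Sum>i\<in>UNIV. (\<Sum>t=1..k. dual_grad P i (xt t i) \<bullet> (m, H)) / real k)"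
    by (intro sum_mono)
  also have "\<dots> = (\<Sum>t=1..k. \<Sum>i\<in>UNIV. dual_grad P i (xt t i) \<bullet> (m, H)) / real k"
    unfolding sum_divide_distrib[symmetric] by (subst sum.swap) (rule refl)
  finally show ?thesis
    by (simp add: sum_dual_grad[symmetric] inner_sum_left)
qed

end

section \<open>The dual domain\<close>

lemma closed_convex_D_mu: "closed (D_mu R)" "convex (D_mu R)"
proof -
  have "D_mu R = {0..R}" by (auto simp: D_mu_def)
  then show "closed (D_mu R)" "convex (D_mu R)" by auto
qed

lemma closed_convex_D_G:
  fixes R :: real
  defines "D \<equiv> D_G R :: (real ^ 'd ^ 'd) set"
  shows "closed D" "convex D"
proof -
  have "D = {A. psd A} \<inter> cball 0 R" by (auto simp: D_def D_G_def)
  then show "closed D" "convex D"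
    by (simp_all add: closed_Int closed_psd convex_Int convex_psd)
qed

text \<open>A multiple of the identity; it turns the assumed bound \<open>\<Gamma>\<close> on the
  dual set into \<open>R \<le> \<Gamma>\<close>.\<close>

lemma D_G_norm_attained:
  assumes "0 \<le> R" obtains H :: "real ^ 'd ^ 'd" where "H \<in> D_G R" "norm H = R"
proof
  have "(mat 1 :: real ^ 'd ^ 'd) $ i $ i \<noteq> 0" for i by (simp add: mat_def)
  then have "norm (mat 1 :: real ^ 'd ^ 'd) \<noteq> 0" by (metis norm_eq_zero zero_index)
  then show "norm ((R / norm (mat 1 :: real ^ 'd ^ 'd)) *\<^sub>R (mat 1 :: real ^ 'd ^ 'd)) = R"
    using assms by simp
  then show "(R / norm (mat 1 :: real ^ 'd ^ 'd)) *\<^sub>R (mat 1 :: real ^ 'd ^ 'd) \<in> D_G R"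
    using assms by (simp add: D_G_def psd_scaleR psd_mat1)
qed

theorem theorem5p3:
  fixes P :: "('v :: finite, 'd :: finite) coupled_problem"
    and E :: "'v rel" and W :: "real ^ 'v ^ 'v"
    and \<nu> \<alpha> r \<mu>t R \<beta>0 c0 M \<tau> \<zeta> \<Lambda> \<Gamma> \<delta> n d :: real
    and \<phi> :: nat
    and xbar :: "real ^ 'v" and Gt :: "real ^ 'd ^ 'd"
    and \<mu> :: "nat \<Rightarrow> 'v \<Rightarrow> real" and G :: "nat \<Rightarrow> 'v \<Rightarrow> real ^ 'd ^ 'd"
    and xt :: "nat \<Rightarrow> 'v \<Rightarrow> real"
    and e :: "nat \<Rightarrow> real"
  assumes n_def: "n = real CARD('v)" and d_def: "d = real CARD('d)"
    and convex: "convex_problem P"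
    and existence: "feasible_set P \<noteq> {}"
    and graph: "sym E"
    and \<nu>: "0 < \<nu>" "\<nu> < 1"
    and W: "consensus_matrix E \<nu> W"
    and slater: "slater_vector P xbar"
    and \<alpha>: "0 < \<alpha>"
    and dual_point: "0 \<le> \<mu>t" "psd Gt"
    and r: "r \<ge> multiplier_bound P xbar \<mu>t Gt" "0 < r"
    and R_def: "R = multiplier_bound P xbar \<mu>t Gt + r"
    and alg: "coba_dd P W \<phi> \<alpha> R \<mu> G xt"
    and iterates_bounded: "\<And>i k. \<bar>\<mu> k i\<bar> \<le> \<Lambda>" "\<And>i k. norm (G k i) \<le> \<Gamma>"
    and D_bounded: "\<And>m. m \<in> D_mu R \<Longrightarrow> \<bar>m\<bar> \<le> \<Lambda>"
      "\<And>H :: real ^ 'd ^ 'd. H \<in> D_G R \<Longrightarrow> norm H \<le> \<Gamma>"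
    and c0: "0 \<le> c0"
      "\<And>i. norm (\<Sum>j\<in>UNIV. (mat_power W \<phi> - avg_mat) $ i $ j * local_mu_step P \<alpha> (\<mu> 0) (xt 0) j)
         + norm (\<Sum>j\<in>UNIV. ((mat_power W \<phi> - avg_mat) $ i $ j) *\<^sub>R local_G_step P \<alpha> (G 0) (xt 0) j)
         \<le> c0"
    and \<beta>0: "c0 \<le> \<beta>0" "0 < \<beta>0"
    and M: "M = bound_L P + bound_Q P" "0 < M"
    and \<tau>: "\<beta>0 / \<alpha> \<le> \<tau>"
    and \<zeta>: "0 < \<zeta>"
      "\<And>z g v. z \<in> D_mu R \<times> D_G R \<Longrightarrow>
         g \<in> eps_subdiff (\<lambda>(m, H). dual_fun P m H) (D_mu R \<times> D_G R) 0 z \<Longrightarrow> norm v \<le> \<tau> \<Longrightarrow>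
         g + v \<in> eps_subdiff (\<lambda>(m, H). dual_fun P m H) (D_mu R \<times> D_G R) \<zeta> z"
    and \<phi>: "0 \<le> \<delta>"
      "real \<phi> \<ge> (ln \<beta>0 - ln (4 * n * (1 + d\<^sup>2) * (\<beta>0 + \<alpha> * M))) / ln \<nu> + \<delta>"
    and e_def: "\<And>k. e k = \<alpha> * n * (M + \<tau>)\<^sup>2 / 2 + n * \<tau> * (\<Lambda> + \<Gamma>)
                  + n * (\<beta>0 * (6 * M + 3 * \<tau>) + \<zeta>)"
  shows "\<forall>k\<ge>1.
      total_cost P (recovered_primal xt k)
        \<le> opt_value P + (\<Lambda>\<^sup>2 + \<Gamma>\<^sup>2) / (2 * real k * \<alpha> / n) + e k \<and>
      total_cost P (recovered_primal xt k)
        \<ge> opt_value P - 9 * (\<Lambda>\<^sup>2 + \<Gamma>\<^sup>2) / (2 * real k * \<alpha> / n) - e k"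
proof (intro allI impI)
  fix k :: nat assume k: "1 \<le> k"
  interpret slater_problem P xbar
    using convex slater by unfold_locales
  obtain m H where mH: "0 \<le> m" "psd H"
    and saddle: "\<And>x. x \<in> product_set P \<Longrightarrow>
      opt_value P \<le> total_cost P x + (total_constr P x, - lmi P x) \<bullet> (m, H)"
    using dual_multiplier_exists by blast
  have mult: "m + norm H \<le> multiplier_bound P xbar \<mu>t Gt"
    by (rule multiplier_le_bound[OF mH dual_point saddle[OF xbar_in]])
  have R: "2 * (m + norm H) \<le> R" using mult r(1) unfolding R_def distrib_left mult_2 by linarith
  then have mR: "2 * m \<le> R" "2 * norm H \<le> R" using mH(1) norm_ge_zero[of H] unfolding distrib_left by linarith+
  have R0: "0 \<le> R" using mR mH by linarith
  let ?Z = "D_mu R \<times> (D_G R :: (real ^ 'd ^ 'd) set)"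
  have Z0: "0 \<in> D_mu R" "(0 :: real ^ 'd ^ 'd) \<in> D_G R"
    using R0 by (auto simp: D_mu_def D_G_def psd_0)
  have Zw: "(2 * m, 2 *\<^sub>R H) \<in> ?Z"
    using mR mH by (auto simp: D_mu_def D_G_def psd_scaleR)
  have \<Lambda>\<Gamma>: "R \<le> \<Lambda>" "R \<le> \<Gamma>"
  proof -
    show "R \<le> \<Lambda>" using D_bounded(1)[of R] R0 by (simp add: D_mu_def)
    obtain K :: "real ^ 'd ^ 'd" where "K \<in> D_G R" "norm K = R" using D_G_norm_attained[OF R0] .
    then show "R \<le> \<Gamma>" using D_bounded(2)[of K] by simp
  qed
  define z where "z k i = (\<mu> k i, G k i)" for k i
  define g where "g k i = dual_grad P i (xt k i)" for k i
  have xt: "xt k i \<in> local_set P i"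
    and xt_min: "local_dual P i (\<mu> k i) (G k i) = local_lagrangian P i (xt k i) (\<mu> k i) (G k i)" for k i
  proof -
    have *: "is_arg_min (\<lambda>t. local_lagrangian P i t (\<mu> k i) (G k i)) (\<lambda>t. t \<in> local_set P i) (xt k i)"
      using alg by (simp add: coba_dd_def)
    then show "xt k i \<in> local_set P i" by (simp add: is_arg_min_def)
    show "local_dual P i (\<mu> k i) (G k i) = local_lagrangian P i (xt k i) (\<mu> k i) (G k i)"
      unfolding local_dual_def using * by (intro cInf_eq_minimum) (auto simp: is_arg_min_linorder)
  qed
  have step_sum: "(\<Sum>j\<in>UNIV. c j *\<^sub>R (z k j + \<alpha> *\<^sub>R g k j))
      = (\<Sum>j\<in>UNIV. c j * local_mu_step P \<alpha> (\<mu> k) (xt k) j, \<Sum>j\<in>UNIV. c j *\<^sub>R local_G_step P \<alpha> (G k) (xt k) j)" for c k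
    by (simp add: z_def g_def dual_grad_def local_mu_step_def local_G_step_def prod_eq_iff fst_sum snd_sum)
  have n0: "1 \<le> n" by (simp add: n_def Suc_leI)
  have dev_pos: "0 < \<beta>0 + \<alpha> * M" using \<beta>0 \<alpha> M by (simp add: add_pos_pos)
  interpret pc: projected_consensus ?Z "mat_power W \<phi>" \<alpha> \<beta>0 M \<tau> z g
  proof
    show "convex ?Z" by (intro convex_Times closed_convex_D_mu closed_convex_D_G)
    show "closed ?Z" by (intro closed_Times closed_convex_D_mu closed_convex_D_G)
    show "?Z \<noteq> {}" using Z0 by blast
    show "z (Suc k) i = closest_point ?Z (\<Sum>j\<in>UNIV. mat_power W \<phi> $ i $ j *\<^sub>R (z k j + \<alpha> *\<^sub>R g k j))" for k i
      unfolding step_sum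
      by (subst closest_point_Times)
        (use alg Z0 closed_convex_D_mu closed_convex_D_G in \<open>auto simp: z_def coba_dd_def\<close>)
    show "norm (g k j) \<le> M" for k j
      unfolding g_def M by (rule norm_dual_grad[OF xt])
    show "(\<Sum>j\<in>UNIV. mat_power W \<phi> $ i $ j) = 1" for i
      using W by (rule consensus_power_row_sum)
    show "(\<Sum>j\<in>UNIV. \<bar>(mat_power W \<phi> - avg_mat) $ i $ j\<bar>) * (\<beta>0 + \<alpha> * M) \<le> \<beta>0" for i
    proof -
      have pow: "4 * n * (1 + d\<^sup>2) * (\<beta>0 + \<alpha> * M) * \<nu> ^ \<phi> \<le> \<beta>0"
        by (rule power_le_of_ln_bound[OF \<nu> \<beta>0(2) _ \<phi>]) (use n0 dev_pos in \<open>auto intro!: mult_pos_pos add_pos_nonneg\<close>)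
      have "(\<Sum>j\<in>UNIV. \<bar>(mat_power W \<phi> - avg_mat) $ i $ j\<bar>) * (\<beta>0 + \<alpha> * M) \<le> 2 * n * \<nu> ^ \<phi> * (\<beta>0 + \<alpha> * M)"
        using consensus_power_row_dev[OF W, of \<phi> i] \<nu> dev_pos by (intro mult_right_mono) (auto simp: n_def)
      \<comment> \<open>The row estimate produces the constant 2n; the remaining factor of the
        logarithm's argument, 2 (1 + d^2), is at least 1.\<close>
      also have "\<dots> \<le> 2 * n * \<nu> ^ \<phi> * (\<beta>0 + \<alpha> * M) * (2 * (1 + d\<^sup>2))"
        using mult_left_mono[of 1 "2 * (1 + d\<^sup>2)" "2 * n * \<nu> ^ \<phi> * (\<beta>0 + \<alpha> * M)"] n0 \<nu> dev_pos by simp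
      also have "\<dots> = 4 * n * (1 + d\<^sup>2) * (\<beta>0 + \<alpha> * M) * \<nu> ^ \<phi>" by simp
      finally show ?thesis using pow by linarith
    qed
    show "norm (\<Sum>j\<in>UNIV. (mat_power W \<phi> - avg_mat) $ i $ j *\<^sub>R (z 0 j + \<alpha> *\<^sub>R g 0 j)) \<le> \<beta>0" for i
      unfolding step_sum using c0(2)[of i] \<beta>0(1) by (intro order_trans[OF norm_Pair_le]) simp
  qed (use \<alpha> \<tau> in auto)
  have n: "pc.n = n" by (simp add: pc.n_def n_def)
  have \<tau>0: "0 \<le> \<tau>" using \<tau> \<beta>0 \<alpha> by (meson divide_nonneg_pos less_eq_real_def order_trans)
  have psd_G: "psd (G t i)" for t i
  proof (cases t)
    case 0
    then show ?thesis using alg by (simp add: coba_dd_def)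
  next
    case (Suc s)
    then have "G t i \<in> D_G R"
      using alg Z0 closed_convex_D_G by (auto simp: coba_dd_def intro: closest_point_in_set)
    then show ?thesis by (simp add: D_G_def)
  qed
  let ?F = "\<lambda>t. \<Sum>i\<in>UNIV. cost P i (xt t i)" and ?g = "\<lambda>t. \<Sum>i\<in>UNIV. g t i"
  let ?w = "(m, H)"
  \<comment> \<open>The error \<open>M * \<beta>0\<close> per node occurs twice: once in moving the
    local dual values to the center, once in moving the pairings with the supergradients.\<close>
  have cost_center: "?F t + ?g t \<bullet> pc.center t \<le> opt_value P + 2 * (n * M * \<beta>0)" if t: "1 \<le> t" for t
  proof -
    obtain c C where cC: "pc.center t = (c, C)" by (cases "pc.center t")
    have c: "0 \<le> c" "psd C" using pc.center_in[of t] unfolding cC by (auto simp: D_mu_def D_G_def)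
    have close: "norm (z t i - (c, C)) \<le> \<beta>0" for i
      using pc.close_to_center[OF t, of i] by (simp add: cC)
    have "?F t + (\<Sum>i\<in>UNIV. g t i \<bullet> z t i) = (\<Sum>i\<in>UNIV. local_dual P i (fst (z t i)) (snd (z t i)))"
      using psd_G by (simp add: z_def g_def xt_min local_lagrangian_eq psd_def sum.distrib)
    also have "\<dots> \<le> dual_fun P c C + n * (M * \<beta>0)"
      unfolding n_def M by (rule sum_local_dual_le) (use psd_G c close in \<open>auto simp: z_def\<close>)
    also have "\<dots> \<le> opt_value P + n * (M * \<beta>0)" using dual_le_opt[OF c] by simp
    finally have 1: "?F t + (\<Sum>i\<in>UNIV. g t i \<bullet> z t i) \<le> opt_value P + n * (M * \<beta>0)" .
    have "g t i \<bullet> ((c, C) - z t i) \<le> M * \<beta>0" for i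
    proof -
      have "g t i \<bullet> ((c, C) - z t i) \<le> norm (g t i) * norm ((c, C) - z t i)" by (rule norm_cauchy_schwarz)
      also have "\<dots> \<le> M * \<beta>0"
        using pc.norm_g[of t i] close[of i] M(2) by (intro mult_mono) (auto simp: norm_minus_commute)
      finally show ?thesis .
    qed
    then have "(\<Sum>i\<in>UNIV. g t i \<bullet> ((c, C) - z t i)) \<le> (\<Sum>i\<in>(UNIV :: 'v set). M * \<beta>0)" by (rule sum_mono)
    then have "?g t \<bullet> (c, C) - (\<Sum>i\<in>UNIV. g t i \<bullet> z t i) \<le> n * (M * \<beta>0)"
      by (simp add: inner_diff_right sum_subtractf inner_sum_left n_def)
    then show ?thesis using 1 by (simp add: cC)
  qed
  have norm_sq: "(norm y)\<^sup>2 = (fst y)\<^sup>2 + (norm (snd y))\<^sup>2" for y :: "real \<times> (real ^ 'd ^ 'd)"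
    by (simp add: norm_prod_def)
  have norm_sq_le: "(norm y)\<^sup>2 \<le> \<Lambda>\<^sup>2 + \<Gamma>\<^sup>2" "(norm y)\<^sup>2 \<le> 2 * R\<^sup>2" if y: "y \<in> ?Z" for y
  proof -
    have y': "\<bar>fst y\<bar> \<le> R" "norm (snd y) \<le> R" using y by (auto simp: D_mu_def D_G_def)
    then have "(fst y)\<^sup>2 \<le> R\<^sup>2" "(norm (snd y))\<^sup>2 \<le> R\<^sup>2"
      using power_mono[OF y'(1), of 2] power_mono[OF y'(2), of 2] by auto
    moreover have "R\<^sup>2 \<le> \<Lambda>\<^sup>2" "R\<^sup>2 \<le> \<Gamma>\<^sup>2" using \<Lambda>\<Gamma> R0 by (auto intro: power_mono)
    ultimately show "(norm y)\<^sup>2 \<le> \<Lambda>\<^sup>2 + \<Gamma>\<^sup>2" "(norm y)\<^sup>2 \<le> 2 * R\<^sup>2" by (auto simp: norm_sq)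
  qed
  have inner_nonneg: "0 \<le> y \<bullet> y'" if "y \<in> ?Z" "y' \<in> ?Z" for y y'
    using that by (auto simp: D_mu_def D_G_def psd_def intro!: add_nonneg_nonneg psd_inner_nonneg)
  \<comment> \<open>Dropping the nonnegative cross term is what bounds distances in
    \<open>?Z\<close> by 2R, hence by \<open>\<Lambda> + \<Gamma>\<close>; the triangle inequality
    with norms up to sqrt 2 R would not.\<close>
  have dist_sq: "(norm (y - y'))\<^sup>2 \<le> (norm y)\<^sup>2 + (norm y')\<^sup>2" if "y \<in> ?Z" "y' \<in> ?Z" for y y'
    using inner_nonneg[OF that] unfolding power2_norm_eq_inner
    by (simp add: inner_diff_left inner_diff_right inner_commute)
  have dist_le: "norm (y - y') \<le> \<Lambda> + \<Gamma>" if "y \<in> ?Z" "y' \<in> ?Z" for y y'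
  proof -
    have "(norm (y - y'))\<^sup>2 \<le> (2 * R)\<^sup>2"
      using dist_sq[OF that] norm_sq_le(2)[OF that(1)] norm_sq_le(2)[OF that(2)] by (simp add: power_mult_distrib)
    then have "norm (y - y') \<le> 2 * R" by (rule power2_le_imp_le) (use R0 in simp)
    then show ?thesis using \<Lambda>\<Gamma> by linarith
  qed
  have drift_le: "pc.drift t \<bullet> (pc.center t - y) \<le> n * \<tau> * (\<Lambda> + \<Gamma>)" if "1 \<le> t" "y \<in> ?Z" for t y
  proof -
    have "pc.drift t \<bullet> (pc.center t - y) \<le> norm (pc.drift t) * norm (pc.center t - y)" by (rule norm_cauchy_schwarz)
    also have "\<dots> \<le> n * \<tau> * (\<Lambda> + \<Gamma>)"
      using pc.norm_drift[OF that(1)] dist_le[OF pc.center_in that(2)] n0 \<tau>0 by (intro mult_mono) (auto simp: n)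
    finally show ?thesis .
  qed
  have average: "(\<Sum>t=1..k. a t) / real k
      \<le> (norm (pc.center 1 - y))\<^sup>2 / (2 * real k * \<alpha> / n) + \<alpha> * n * (M + \<tau>)\<^sup>2 / 2 + b"
    if y: "y \<in> ?Z" and a: "\<And>t. 1 \<le> t \<Longrightarrow> a t \<le> pc.direction t \<bullet> (y - pc.center t) + b" for a b y
  proof -
    have "(\<Sum>t=1..k. a t) \<le> (\<Sum>t=1..k. pc.direction t \<bullet> (y - pc.center t) + b)"
      using a by (intro sum_mono) auto
    then have "(\<Sum>t=1..k. a t) / real k \<le> (\<Sum>t=1..k. pc.direction t \<bullet> (y - pc.center t) + b) / real k"
      by (intro divide_right_mono) auto
    also have "\<dots> = (\<Sum>t=1..k. pc.direction t \<bullet> (y - pc.center t)) / real k + b"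
      using k by (simp add: sum.distrib add_divide_distrib)
    finally show ?thesis using pc.average_direction_le[OF k y] by (simp add: n)
  qed
  have mono: "a / (2 * real k * \<alpha> / n) \<le> b / (2 * real k * \<alpha> / n)" if "a \<le> b" for a b
    using that n0 \<alpha> by (intro divide_right_mono) auto
  have e: "\<alpha> * n * (M + \<tau>)\<^sup>2 / 2 + (n * \<tau> * (\<Lambda> + \<Gamma>) + 2 * (n * M * \<beta>0)) \<le> e k"
  proof -
    \<comment> \<open>This is exactly the right side minus the left side of the claim.\<close>
    have "0 \<le> n * (\<beta>0 * (4 * M + 3 * \<tau>) + \<zeta>)" using n0 \<beta>0 M \<tau>0 \<zeta> by simp
    then show ?thesis by (simp add: e_def algebra_simps)
  qed
  have "total_cost P (recovered_primal xt k) - opt_value P \<le> (\<Sum>t=1..k. ?F t - opt_value P) / real k"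
    using recovered_cost_le[OF k, of xt] k by (simp add: sum_subtractf diff_divide_distrib)
  also have "\<dots> \<le> (norm (pc.center 1 - 0))\<^sup>2 / (2 * real k * \<alpha> / n) + \<alpha> * n * (M + \<tau>)\<^sup>2 / 2
      + (n * \<tau> * (\<Lambda> + \<Gamma>) + 2 * (n * M * \<beta>0))"
  proof (rule average)
    show Z0': "0 \<in> ?Z" using Z0 by (simp add: zero_prod_def)
    fix t :: nat assume t: "1 \<le> t"
    show "?F t - opt_value P \<le> pc.direction t \<bullet> (0 - pc.center t) + (n * \<tau> * (\<Lambda> + \<Gamma>) + 2 * (n * M * \<beta>0))"
      using cost_center[OF t] drift_le[OF t Z0'] by (simp add: pc.direction_def inner_add_left)
  qed
  also have "(norm (pc.center 1 - 0))\<^sup>2 / (2 * real k * \<alpha> / n) \<le> (\<Lambda>\<^sup>2 + \<Gamma>\<^sup>2) / (2 * real k * \<alpha> / n)"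
    using norm_sq_le(1)[OF pc.center_in[of 1]] by (intro mono) simp
  finally have upper: "total_cost P (recovered_primal xt k)
      \<le> opt_value P + (\<Lambda>\<^sup>2 + \<Gamma>\<^sup>2) / (2 * real k * \<alpha> / n) + e k"
    using e by linarith
  text \<open>Twice the multiplier is still an admissible comparison point: this is what the
    condition on \<open>r\<close> is for.\<close>
  have "opt_value P - total_cost P (recovered_primal xt k) \<le> (\<Sum>t=1..k. ?g t \<bullet> ?w) / real k"
    using saddle[OF recovered_primal_in[of xt, OF xt k]] recovered_constraints_le[OF k mH(1), of xt H]
    by (simp add: g_def)
  also have "\<dots> \<le> (norm (pc.center 1 - (2 * m, 2 *\<^sub>R H)))\<^sup>2 / (2 * real k * \<alpha> / n) + \<alpha> * n * (M + \<tau>)\<^sup>2 / 2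
      + (n * \<tau> * (\<Lambda> + \<Gamma>) + 2 * (n * M * \<beta>0))"
  proof (rule average[OF Zw])
    fix t :: nat assume t: "1 \<le> t"
    have "(\<chi> i. xt t i) \<in> product_set P" using xt by (simp add: product_set_def)
    from saddle[OF this] have "opt_value P \<le> ?F t + ?g t \<bullet> ?w"
      using sum_dual_grad[of P "\<chi> i. xt t i"] by (simp add: g_def total_cost_def)
    moreover have "(2 * m, 2 *\<^sub>R H) = 2 *\<^sub>R ?w" by simp
    \<comment> \<open>Combining the saddle inequality with \<open>cost_center\<close> bounds the
      pairing at the center by the one at \<open>?w\<close> plus the error; adding one more copy of
      the pairing at \<open>?w\<close> produces the doubled comparison point.\<close>
    ultimately show "?g t \<bullet> ?w \<le> pc.direction t \<bullet> ((2 * m, 2 *\<^sub>R H) - pc.center t)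
        + (n * \<tau> * (\<Lambda> + \<Gamma>) + 2 * (n * M * \<beta>0))"
      using cost_center[OF t] drift_le[OF t Zw]
      by (simp add: pc.direction_def inner_add_left inner_diff_right del: scaleR_Pair inner_Pair)
  qed
  also have "(norm (pc.center 1 - (2 * m, 2 *\<^sub>R H)))\<^sup>2 / (2 * real k * \<alpha> / n)
      \<le> (9 * (\<Lambda>\<^sup>2 + \<Gamma>\<^sup>2)) / (2 * real k * \<alpha> / n)"
    using dist_sq[OF pc.center_in Zw, of 1] norm_sq_le(1)[OF pc.center_in[of 1]] norm_sq_le(1)[OF Zw]
    by (intro mono) (smt (verit) zero_le_power2)
  finally have lower: "total_cost P (recovered_primal xt k)
      \<ge> opt_value P - 9 * (\<Lambda>\<^sup>2 + \<Gamma>\<^sup>2) / (2 * real k * \<alpha> / n) - e k"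
    using e by linarith
  show "total_cost P (recovered_primal xt k) \<le> opt_value P + (\<Lambda>\<^sup>2 + \<Gamma>\<^sup>2) / (2 * real k * \<alpha> / n) + e k \<and>
      total_cost P (recovered_primal xt k) \<ge> opt_value P - 9 * (\<Lambda>\<^sup>2 + \<Gamma>\<^sup>2) / (2 * real k * \<alpha> / n) - e k"
    using upper lower by blast
qed

end
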